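(* Let $g:\mathbb{R}\to\mathbb{R}$ be continuous and monotone, and suppose that $G(x)=E_x\left[\int_0^\infty g(X_t)e^{-rt}\,dt\right]$ satisfies $|G(x)|<\infty$ for all $x\in\mathbb{R}$. If $g$ is increasing, then for all $x\in\mathbb{R}$ $$G(x)=E_x\left[\int_0^\infty\sup_{0\le s\le t}\kappa(X_s)\,re^{-rt}\,dt\right],\qquad \kappa(x):=\frac1rE_0\left[g\left(x+\underline{X}'_{T'(r)}\right)\right].$$ If $g$ is decreasing, then for all $x\in\mathbb{R}$ $$G(x)=E_x\left[\int_0^\infty\sup_{0\le s\le t}\mu(X_s)\,re^{-rt}\,dt\right],\qquad \mu(x):=\frac1rE_0\left[g\left(x+\overline{X}'_{T'(r)}\right)\right].$$
   Context: $X=(X_t)_{t\ge0}$ is a real-valued Lévy process with $X_0=x$ under $P_x$ ($x\in\mathbb{R}$), $E_x$ denotes expectation under $P_x$, and $r>0$ is a constant. $X'$ is an independent copy of $X$, and $T'(r)$ is an exponentially distributed random variable with parameter $r$ independent of $X$ and $X'$. The running supremum and infimum are $\overline{X}'_t=\sup_{0\le s\le t}X'_s$ and $\underline{X}'_t=\inf_{0\le s\le t}X'_s$ (with $X'_0=0$ under $P_0$). *)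

theory Defs
  imports "HOL-Probability.Probability"
begin

text \<open>Processes are functions \<open>X :: real \<Rightarrow> 'a \<Rightarrow> real\<close> (time, then sample point) of which only the
  times \<open>t \<ge> 0\<close> are used.\<close>

definition cadlag :: "(real \<Rightarrow> real) \<Rightarrow> bool" where
  "cadlag f \<longleftrightarrow>
     (\<forall>t\<ge>0. (f \<longlongrightarrow> f t) (at_right t)) \<and>
     (\<forall>t>0. \<exists>l. (f \<longlongrightarrow> l) (at_left t))"

definition levy_process :: "'a measure \<Rightarrow> (real \<Rightarrow> 'a \<Rightarrow> real) \<Rightarrow> real \<Rightarrow> bool" where
  "levy_process M X x \<longleftrightarrow>
     prob_space M \<and>
     (\<forall>t\<ge>0. X t \<in> borel_measurable M) \<and>
     (AE \<omega> in M. X 0 \<omega> = x) \<and>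
     (\<forall>\<omega>\<in>space M. cadlag (\<lambda>t. X t \<omega>)) \<and>
     (\<forall>(n::nat) t. 0 \<le> t 0 \<and> mono t \<longrightarrow>
        prob_space.indep_vars M (\<lambda>_. borel) (\<lambda>i \<omega>. X (t (Suc i)) \<omega> - X (t i) \<omega>) {..<n}) \<and>
     (\<forall>s\<ge>0. \<forall>h\<ge>0. distr M borel (\<lambda>\<omega>. X (s + h) \<omega> - X s \<omega>) = distr M borel (\<lambda>\<omega>. X h \<omega> - X 0 \<omega>))"

definition path_space :: "(real \<Rightarrow> real) measure" where
  "path_space = (\<Pi>\<^sub>M t\<in>{0..}. borel)"

definition path :: "(real \<Rightarrow> 'a \<Rightarrow> real) \<Rightarrow> 'a \<Rightarrow> real \<Rightarrow> real" where
  "path X \<omega> = (\<lambda>t\<in>{0..}. X t \<omega>)"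

text \<open>\<open>P x\<close> is the measure under which the process starts in \<open>x\<close>; the law of the process under
  \<open>P x\<close> is that of \<open>x\<close> plus the process under \<open>P 0\<close>.\<close>

definition levy_family :: "(real \<Rightarrow> 'a measure) \<Rightarrow> (real \<Rightarrow> 'a \<Rightarrow> real) \<Rightarrow> bool" where
  "levy_family P X \<longleftrightarrow>
     (\<forall>x. levy_process (P x) X x \<and>
          distr (P x) path_space (path X) = distr (P 0) path_space (path (\<lambda>t \<omega>. x + X t \<omega>)))"

definition generated_sets :: "'a measure \<Rightarrow> 'b measure \<Rightarrow> ('a \<Rightarrow> 'b) \<Rightarrow> 'a set set" where
  "generated_sets M N f = sets (vimage_algebra (space M) f N)"

definition independent_copy ::
    "(real \<Rightarrow> 'a measure) \<Rightarrow> (real \<Rightarrow> 'a \<Rightarrow> real) \<Rightarrow> (real \<Rightarrow> 'a \<Rightarrow> real) \<Rightarrow> bool" where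
  "independent_copy P X X' \<longleftrightarrow>
     levy_family P X' \<and>
     (\<forall>x. distr (P x) path_space (path X') = distr (P x) path_space (path X) \<and>
          prob_space.indep_set (P x)
            (generated_sets (P x) path_space (path X))
            (generated_sets (P x) path_space (path X')))"

definition independent_exponential_time ::
    "(real \<Rightarrow> 'a measure) \<Rightarrow> (real \<Rightarrow> 'a \<Rightarrow> real) \<Rightarrow> (real \<Rightarrow> 'a \<Rightarrow> real) \<Rightarrow> ('a \<Rightarrow> real) \<Rightarrow> real \<Rightarrow> bool" where
  "independent_exponential_time P X X' T r \<longleftrightarrow>
     (\<forall>x. distributed (P x) lborel T (exponential_density r) \<and>
          prob_space.indep_set (P x)
            (generated_sets (P x) borel T)
            (generated_sets (P x) (path_space \<Otimes>\<^sub>M path_space) (\<lambda>\<omega>. (path X \<omega>, path X' \<omega>))))"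

definition running_sup :: "(real \<Rightarrow> 'a \<Rightarrow> real) \<Rightarrow> real \<Rightarrow> 'a \<Rightarrow> real" where
  "running_sup Y t \<omega> = (SUP s\<in>{0..t}. Y s \<omega>)"

definition running_inf :: "(real \<Rightarrow> 'a \<Rightarrow> real) \<Rightarrow> real \<Rightarrow> 'a \<Rightarrow> real" where
  "running_inf Y t \<omega> = (INF s\<in>{0..t}. Y s \<omega>)"

text \<open>The expectation of \<open>\<integral>\<^sub>0\<^sup>\<infinity> Y\<^sub>t dt\<close>. Since the Bochner integral of a non-integrable function is
  \<open>0\<close>, existence and finiteness of this iterated integral are a separate predicate.\<close>

definition mean_time_integral :: "'a measure \<Rightarrow> (real \<Rightarrow> 'a \<Rightarrow> real) \<Rightarrow> real" where
  "mean_time_integral M Y = (LINT \<omega>|M. (LINT t:{0..}|lborel. Y t \<omega>))"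

definition finite_mean_time_integral :: "'a measure \<Rightarrow> (real \<Rightarrow> 'a \<Rightarrow> real) \<Rightarrow> bool" where
  "finite_mean_time_integral M Y \<longleftrightarrow>
     (AE \<omega> in M. set_integrable lborel {0..} (\<lambda>t. Y t \<omega>)) \<and>
     integrable M (\<lambda>\<omega>. LINT t:{0..}|lborel. Y t \<omega>)"

definition kappa ::
    "(real \<Rightarrow> 'a measure) \<Rightarrow> (real \<Rightarrow> 'a \<Rightarrow> real) \<Rightarrow> ('a \<Rightarrow> real) \<Rightarrow> real \<Rightarrow> (real \<Rightarrow> real) \<Rightarrow> real \<Rightarrow> real" where
  "kappa P X' T r g x = (1 / r) * (LINT \<omega>|P 0. g (x + running_inf X' (T \<omega>) \<omega>))"

definition mu ::
    "(real \<Rightarrow> 'a measure) \<Rightarrow> (real \<Rightarrow> 'a \<Rightarrow> real) \<Rightarrow> ('a \<Rightarrow> real) \<Rightarrow> real \<Rightarrow> (real \<Rightarrow> real) \<Rightarrow> real \<Rightarrow> real" where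
  "mu P X' T r g x = (1 / r) * (LINT \<omega>|P 0. g (x + running_sup X' (T \<omega>) \<omega>))"

end

theory Submission
  imports Defs
begin

text \<open>
  Let \<open>T\<close> be an exponential time with parameter \<open>r\<close> that is independent of the Levy process, and let
  \<open>S\<close> and \<open>I\<close> be the running supremum and infimum at \<open>T\<close> of the process started in \<open>0\<close>. Then
  \<open>r * G x\<close> is the expectation of \<open>g (x + X\<^sub>T)\<close>. By the Wiener-Hopf factorization
  (\<open>Wiener_Hopf_factorization\<close>), \<open>X\<^sub>T\<close> has the law of a sum of independent copies of \<open>S\<close> and \<open>I\<close>.
  Let \<open>g\<close> be increasing. Integrating out \<open>I\<close> first turns \<open>g (x + S + I)\<close> into \<open>r * kappa (x + S)\<close>.
  The function \<open>kappa\<close> is increasing and continuous, hence \<open>kappa (x + S)\<close> is the running supremum of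
  \<open>kappa\<close> along the process, evaluated at \<open>T\<close>, and writing out the exponential density gives the claim.
  The decreasing case is the increasing case for \<open>- X\<close> and \<open>\<lambda>z. g (- z)\<close>.

  The factorization is proved by discretization. Along a grid the process is a random walk and \<open>T\<close>
  becomes a geometric time. Splitting the path of the walk at its first maximum expresses the joint
  transform of the maximum and of the distance to it as a convolution in time
  (\<open>split_at_first_maximum\<close>), so its generating function is a product and the two variables are
  independent at a geometric time; reversing the steps identifies the distance to the maximum with the
  minimum in law. The mesh then tends to \<open>0\<close>, where right-continuity of the paths is used.

  A second difficulty is integrability. Finiteness of \<open>G\<close> is an assumption on the iterated integral, in
  which infinite positive and negative parts might cancel after the integration over time, while Fubini
  requires \<open>g (x + X\<^sub>T)\<close> to be integrable. This cannot happen, since increasing functionals of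
  independent increments are positively correlated (\<open>Harris_inequality\<close>); \<open>integrable_of_iterated\<close>
  carries out this argument. Integrability of \<open>g (y + I)\<close> for every \<open>y\<close> then follows from the
  factorization (\<open>integrable_fall_shift\<close>).
\<close>

section \<open>Right-hand grids and cadlag paths\<close>

text \<open>
  The index of the first grid point (as numbered by \<open>grid_time\<close> below) that is not smaller than
  \<open>t\<close>. Rounding up makes the event \<open>grid_index m t \<le> n\<close> exactly \<open>t \<le> grid_time m n\<close>, so the law of
  the index of a random time is read off from its distribution function.
\<close>

definition grid_index :: "nat \<Rightarrow> real \<Rightarrow> nat" where
  "grid_index m t = nat \<lceil>real (Suc m) * t\<rceil> - 1"

text \<open>
  The grid starts at \<open>1 / (m + 1)\<close> instead of \<open>0\<close>. Every time, \<open>0\<close> included, is then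
  approximated by grid points that are not smaller, which is the side on which a cadlag path converges.
  Along this grid a Levy process still has i.i.d. steps, and the index of an exponential time is geometric
  from \<open>0\<close> on.
\<close>

definition grid_time :: "nat \<Rightarrow> nat \<Rightarrow> real" where
  "grid_time m j = (real j + 1) / real (Suc m)"

lemma grid_time_nonneg: "0 \<le> grid_time m j"
  by (simp add: grid_time_def)

lemma grid_time_mono: "i \<le> j \<Longrightarrow> grid_time m i \<le> grid_time m j"
  by (simp add: grid_time_def divide_right_mono)

lemma grid_index_mono: "s \<le> t \<Longrightarrow> grid_index m s \<le> grid_index m t"
  unfolding grid_index_def
  by (intro diff_le_mono nat_mono ceiling_mono mult_left_mono) auto

lemma grid_index_le_iff: "grid_index m t \<le> n \<longleftrightarrow> t \<le> grid_time m n"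
proof -
  have "grid_index m t \<le> n \<longleftrightarrow> \<lceil>real (Suc m) * t\<rceil> \<le> int n + 1"
    unfolding grid_index_def by linarith
  also have "\<dots> \<longleftrightarrow> real (Suc m) * t \<le> real n + 1"
    by (simp add: ceiling_le_iff)
  also have "\<dots> \<longleftrightarrow> t \<le> grid_time m n"
    unfolding grid_time_def by (simp add: field_simps)
  finally show ?thesis .
qed

lemma grid_time_index_ge: "t \<le> grid_time m (grid_index m t)"
  using grid_index_le_iff by blast

lemma grid_time_index_le:
  assumes "0 \<le> t"
  shows "grid_time m (grid_index m t) \<le> t + 1 / real (Suc m)"
proof (cases "grid_index m t")
  case 0
  then show ?thesis using assms by (simp add: grid_time_def)
next
  case (Suc k)
  have "\<not> grid_index m t \<le> k" using Suc by simp
  then have "grid_time m k < t" by (simp add: grid_index_le_iff)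
  moreover have "grid_time m (Suc k) = grid_time m k + 1 / real (Suc m)"
    by (simp add: grid_time_def add_divide_distrib)
  ultimately show ?thesis using Suc by simp
qed

lemma grid_time_before:
  assumes "0 \<le> t" "j < grid_index m t"
  shows "grid_time m j < t"
  using assms grid_index_le_iff[of m t j] by linarith

lemma grid_time_0_tendsto: "(\<lambda>m. grid_time m 0) \<longlonglongrightarrow> 0"
  using LIMSEQ_inverse_real_of_nat by (simp add: grid_time_def inverse_eq_divide)

lemma grid_time_index_tendsto:
  assumes "0 \<le> t"
  shows "(\<lambda>m. grid_time m (grid_index m t)) \<longlonglongrightarrow> t"
proof (rule tendsto_sandwich[OF _ _ tendsto_const])
  show "(\<lambda>m. t + 1 / real (Suc m)) \<longlonglongrightarrow> t"
    using tendsto_add[OF tendsto_const LIMSEQ_inverse_real_of_nat, of t]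
    by (simp add: inverse_eq_divide)
qed (intro always_eventually allI grid_time_index_ge grid_time_index_le assms)+

lemma cadlag_right_limit:
  assumes f: "cadlag f" and t: "0 \<le> t" and u: "u \<longlonglongrightarrow> t" "\<And>m. t \<le> u m"
  shows "(\<lambda>m. f (u m)) \<longlonglongrightarrow> f t"
proof -
  have "(f \<longlongrightarrow> f t) (at t within {t..})"
    using f t unfolding cadlag_def by (simp add: at_within_Ici_at_right)
  then have "continuous (at t within {t..}) f" by (simp add: continuous_within)
  then show ?thesis
    by (rule continuous_within_tendsto_compose') (use u in auto)
qed

lemma cadlag_grid_tendsto:
  assumes "cadlag f"
  shows "(\<lambda>m. f (grid_time m (grid_index m t))) \<longlonglongrightarrow> f (max 0 t)"
proof (cases "0 \<le> t")
  case True
  then show ?thesis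
    using cadlag_right_limit[OF assms True grid_time_index_tendsto] grid_time_index_ge by simp
next
  case False
  then have "grid_index m t = 0" for m
    using grid_index_le_iff[of m t 0] grid_time_nonneg[of m 0] by simp
  then show ?thesis
    using False cadlag_right_limit[OF assms _ grid_time_0_tendsto] grid_time_nonneg by simp
qed

lemma cadlag_locally_bounded:
  assumes f: "cadlag f" and s: "0 \<le> s"
  obtains U B where "open U" "s \<in> U" "\<And>u. u \<in> U \<Longrightarrow> 0 \<le> u \<Longrightarrow> \<bar>f u\<bar> \<le> B"
proof -
  have ev: "\<exists>B. eventually (\<lambda>u. \<bar>f u\<bar> \<le> B) F" if "(f \<longlongrightarrow> l) F" for l F
  proof -
    have "eventually (\<lambda>u. dist (f u) l < 1) F" using that by (rule tendstoD) simp
    then have "eventually (\<lambda>u. \<bar>f u\<bar> \<le> \<bar>l\<bar> + 1) F"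
      by eventually_elim (auto simp: dist_real_def)
    then show ?thesis by blast
  qed
  obtain B1 where B1: "eventually (\<lambda>u. \<bar>f u\<bar> \<le> B1) (at_right s)"
    using f s ev unfolding cadlag_def by blast
  obtain B2 where B2: "eventually (\<lambda>u. 0 \<le> u \<longrightarrow> \<bar>f u\<bar> \<le> B2) (at_left s)"
  proof (cases "s = 0")
    case True
    have "eventually (\<lambda>u. u < (0::real)) (at_left 0)" by (simp add: eventually_at_filter)
    then have "eventually (\<lambda>u. 0 \<le> u \<longrightarrow> \<bar>f u\<bar> \<le> 0) (at_left 0)"
      by eventually_elim auto
    then show ?thesis using that True by blast
  next
    case False
    then obtain l where "(f \<longlongrightarrow> l) (at_left s)" using f s unfolding cadlag_def by force
    from ev[OF this] obtain B2 where "eventually (\<lambda>u. \<bar>f u\<bar> \<le> B2) (at_left s)" by blast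
    then have "eventually (\<lambda>u. 0 \<le> u \<longrightarrow> \<bar>f u\<bar> \<le> B2) (at_left s)"
      by eventually_elim auto
    then show ?thesis by (rule that)
  qed
  define B where "B = max (max B1 B2) \<bar>f s\<bar>"
  have "eventually (\<lambda>u. 0 \<le> u \<longrightarrow> \<bar>f u\<bar> \<le> B) (at s)"
    unfolding eventually_at_split
  proof
    show "eventually (\<lambda>u. 0 \<le> u \<longrightarrow> \<bar>f u\<bar> \<le> B) (at_left s)"
      using B2 by eventually_elim (auto simp: B_def)
    show "eventually (\<lambda>u. 0 \<le> u \<longrightarrow> \<bar>f u\<bar> \<le> B) (at_right s)"
      using B1 by eventually_elim (auto simp: B_def)
  qed
  then obtain U where "open U" "s \<in> U" "\<And>u. u \<in> U \<Longrightarrow> u \<noteq> s \<Longrightarrow> 0 \<le> u \<longrightarrow> \<bar>f u\<bar> \<le> B"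
    unfolding eventually_at_topological by blast
  moreover have "\<bar>f s\<bar> \<le> B" by (simp add: B_def)
  ultimately show ?thesis using that by metis
qed

text \<open>
  One-sided limits bound a cadlag path near each point; finitely many of these neighbourhoods cover
  the compact interval.
\<close>

lemma cadlag_bounded:
  assumes f: "cadlag f"
  obtains B where "\<And>s. s \<in> {0..t} \<Longrightarrow> \<bar>f s\<bar> \<le> B"
proof -
  have "\<forall>s\<in>{0..t}. \<exists>U B. open U \<and> s \<in> U \<and> (\<forall>u\<in>U. 0 \<le> u \<longrightarrow> \<bar>f u\<bar> \<le> B)"
    using cadlag_locally_bounded[OF f] by (metis atLeastAtMost_iff)
  then obtain U b where U: "\<And>s. s \<in> {0..t} \<Longrightarrow> open (U s) \<and> s \<in> U s"
    and b: "\<And>s u. s \<in> {0..t} \<Longrightarrow> u \<in> U s \<Longrightarrow> 0 \<le> u \<Longrightarrow> \<bar>f u\<bar> \<le> b s"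
    by metis
  have "{0..t} \<subseteq> (\<Union>s\<in>{0..t}. U s)" using U by blast
  with U obtain C where C: "C \<subseteq> {0..t}" "finite C" "{0..t} \<subseteq> (\<Union>s\<in>C. U s)"
    using compactE_image[of "{0..t}" "{0..t}" U] compact_Icc by metis
  have "\<bar>f s\<bar> \<le> (\<Sum>c\<in>C. \<bar>b c\<bar>)" if s: "s \<in> {0..t}" for s
  proof -
    obtain c where "c \<in> C" "s \<in> U c" using C s by blast
    then have "\<bar>f s\<bar> \<le> \<bar>b c\<bar>" using b[of c s] C s by force
    also have "\<dots> \<le> (\<Sum>c\<in>C. \<bar>b c\<bar>)" using C \<open>c \<in> C\<close> by (intro member_le_sum) auto
    finally show ?thesis .
  qed
  then show ?thesis using that by blast
qed

lemma cadlag_bdd_above: "cadlag f \<Longrightarrow> bdd_above (f ` {0..t})"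
  by (rule cadlag_bounded[of f t], assumption, rule bdd_aboveI2) (auto simp: abs_le_iff)

lemma cadlag_uminus: "cadlag f \<Longrightarrow> cadlag (\<lambda>t. - f t)"
  unfolding cadlag_def by (blast intro: tendsto_minus)

lemma cadlag_bdd_below:
  assumes "cadlag f"
  shows "bdd_below (f ` {0..t})"
proof -
  obtain B where "\<And>s. s \<in> {0..t} \<Longrightarrow> \<bar>f s\<bar> \<le> B" using cadlag_bounded[OF assms] by metis
  then show ?thesis by (intro bdd_belowI2[where m = "- B"]) (force simp: abs_le_iff)
qed

text \<open>
  All the grid points used are smaller than the endpoint of the interval, except the last one, which
  tends to the endpoint from the right; by right-continuity it cannot exceed the supremum in the limit.
  Conversely, a near-maximizer \<open>s\<close> is the limit of grid points from the right.
\<close>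

lemma cadlag_grid_Max_tendsto:
  assumes f: "cadlag f"
  shows "(\<lambda>m. Max ((\<lambda>j. f (grid_time m j)) ` {..grid_index m t}))
           \<longlonglongrightarrow> (SUP s\<in>{0..max 0 t}. f s)"
proof (rule LIMSEQ_I)
  fix \<epsilon> :: real assume e: "0 < \<epsilon>"
  let ?t = "max 0 t"
  let ?S = "SUP s\<in>{0..?t}. f s"
  have ne: "{0..?t} \<noteq> {}" by auto
  have le: "f s \<le> ?S" if "s \<in> {0..?t}" for s
    using cadlag_bdd_above[OF f] that by (intro cSUP_upper)
  obtain s where s: "s \<in> {0..?t}" "?S - \<epsilon> < f s"
    using less_cSUP_iff[OF ne cadlag_bdd_above[OF f], of "?S - \<epsilon>"] e by auto
  have idx: "grid_index m ?t = grid_index m t" for m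
  proof (cases "0 \<le> t")
    case False
    then show ?thesis
      using grid_index_le_iff[of m t 0] grid_index_le_iff[of m 0 0] grid_time_nonneg[of m 0] by simp
  qed simp
  have lim1: "eventually (\<lambda>m. ?S - \<epsilon> < f (grid_time m (grid_index m s))) sequentially"
    using cadlag_grid_tendsto[OF f, of s] s by (intro order_tendstoD) auto
  have lim2: "eventually (\<lambda>m. f (grid_time m (grid_index m ?t)) < ?S + \<epsilon>) sequentially"
    using cadlag_grid_tendsto[OF f, of ?t] le[of ?t] e by (intro order_tendstoD) auto
  from lim1 lim2 have "eventually (\<lambda>m. norm (Max ((\<lambda>j. f (grid_time m j)) ` {..grid_index m t}) - ?S) < \<epsilon>) sequentially"
  proof eventually_elim
    case (elim m)
    let ?M = "Max ((\<lambda>j. f (grid_time m j)) ` {..grid_index m t})"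
    have "grid_index m s \<le> grid_index m t"
      using s grid_index_mono[of s ?t m] idx by simp
    then have "f (grid_time m (grid_index m s)) \<le> ?M" by (intro Max_ge) auto
    then have 1: "?S - \<epsilon> < ?M" using elim by simp
    have "f (grid_time m j) < ?S + \<epsilon>" if "j \<le> grid_index m t" for j
    proof (cases "j = grid_index m ?t")
      case True then show ?thesis using elim by simp
    next
      case False
      then have "grid_time m j < ?t" using that idx by (intro grid_time_before) auto
      then show ?thesis using le[of "grid_time m j"] grid_time_nonneg[of m j] e by fastforce
    qed
    then have "?M < ?S + \<epsilon>" by (subst Max_less_iff) auto
    with 1 show ?case unfolding real_norm_def by linarith
  qed
  then show "\<exists>no. \<forall>m\<ge>no. norm (Max ((\<lambda>j. f (grid_time m j)) ` {..grid_index m t}) - ?S) < \<epsilon>"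
    by (simp add: eventually_sequentially)
qed

lemma uminus_Max_image:
  fixes f :: "'b \<Rightarrow> real"
  assumes "finite A" "A \<noteq> {}"
  shows "- Max ((\<lambda>j. - f j) ` A) = Min (f ` A)"
proof -
  have "Min (f ` A) \<in> f ` A" using assms by (intro Min_in) auto
  moreover have "Min (f ` A) \<le> f j" if "j \<in> A" for j using assms that by auto
  ultimately have "Max ((\<lambda>j. - f j) ` A) = - Min (f ` A)"
    using assms by (intro Max_eqI) (fastforce simp: image_iff)+
  then show ?thesis by simp
qed

lemma uminus_SUP_uminus:
  fixes f :: "'b \<Rightarrow> real"
  shows "- (SUP s\<in>A. - f s) = (INF s\<in>A. f s)"
  by (simp add: Inf_real_def image_image)

lemma cadlag_grid_Min_tendsto:
  assumes f: "cadlag f"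
  shows "(\<lambda>m. Min ((\<lambda>j. f (grid_time m j)) ` {..grid_index m t}))
           \<longlonglongrightarrow> (INF s\<in>{0..max 0 t}. f s)"
  using tendsto_minus[OF cadlag_grid_Max_tendsto[OF cadlag_uminus[OF f], of t]]
  unfolding uminus_SUP_uminus by (subst (asm) uminus_Max_image) auto

section \<open>Exponential times on a grid\<close>

definition expo :: "real \<Rightarrow> real measure" where
  "expo r = density lborel (exponential_density r)"

lemma sets_expo [simp, measurable_cong]: "sets (expo r) = sets borel"
  by (simp add: expo_def)

lemma space_expo [simp]: "space (expo r) = UNIV"
  by (simp add: expo_def)

lemma prob_space_expo: "0 < r \<Longrightarrow> prob_space (expo r)"
  unfolding expo_def by (rule prob_space_exponential_density)

lemma AE_expo_nonneg: "AE t in expo r. 0 \<le> t"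
  unfolding expo_def by (auto simp: AE_density exponential_density_def intro!: AE_I2)

lemma integral_expo:
  fixes f :: "real \<Rightarrow> real"
  assumes "0 < r" and f: "f \<in> borel_measurable borel"
  shows "(LINT t|expo r. f t) = (LINT t:{0..}|lborel. f t * (r * exp (- r * t)))"
proof -
  have "(LINT t|expo r. f t) = (LINT t|lborel. exponential_density r t *\<^sub>R f t)"
    unfolding expo_def using assms by (intro integral_density) auto
  also have "\<dots> = (LINT t:{0..}|lborel. f t * (r * exp (- r * t)))"
    unfolding set_lebesgue_integral_def
    by (intro Bochner_Integration.integral_cong) (auto simp: exponential_density_def indicator_def)
  finally show ?thesis .
qed

lemma integrable_expo:
  fixes f :: "real \<Rightarrow> real"
  assumes "0 < r" and f: "f \<in> borel_measurable borel"
  shows "integrable (expo r) f \<longleftrightarrow> set_integrable lborel {0..} (\<lambda>t. f t * (r * exp (- r * t)))"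
proof -
  have "integrable (expo r) f \<longleftrightarrow> integrable lborel (\<lambda>t. exponential_density r t *\<^sub>R f t)"
    unfolding expo_def using assms by (intro integrable_density) auto
  also have "\<dots> \<longleftrightarrow> set_integrable lborel {0..} (\<lambda>t. f t * (r * exp (- r * t)))"
    unfolding set_integrable_def
    by (intro Bochner_Integration.integrable_cong refl)
      (auto simp: exponential_density_def indicator_def)
  finally show ?thesis .
qed

lemma measure_expo_atMost:
  assumes "0 < r" "0 \<le> a"
  shows "measure (expo r) {..a} = 1 - exp (- r * a)"
  using assms unfolding measure_def expo_def
  by (simp add: emeasure_erlang_density erlang_CDF_def)

lemma grid_index_measurable [measurable]: "grid_index m \<in> borel \<rightarrow>\<^sub>M count_space UNIV"
  unfolding grid_index_def by measurable

lemma measure_expo_grid_index: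
  fixes m n :: nat
  assumes r: "0 < r"
  defines "q \<equiv> exp (- r / real (Suc m))"
  shows "measure (expo r) {t. grid_index m t = n} = (1 - q) * q ^ n"
proof -
  interpret prob_space "expo r" by (rule prob_space_expo[OF r])
  have cdf: "measure (expo r) {t. grid_index m t \<le> n} = 1 - q ^ Suc n" for n
  proof -
    have "{t. grid_index m t \<le> n} = {..grid_time m n}" by (auto simp: grid_index_le_iff)
    moreover have "exp (- r * grid_time m n) = q ^ Suc n"
      unfolding q_def grid_time_def exp_of_nat_mult[symmetric] by (simp add: field_simps)
    ultimately show ?thesis
      using measure_expo_atMost[OF r grid_time_nonneg] by simp
  qed
  show ?thesis
  proof (cases n)
    case 0
    then show ?thesis using cdf[of 0] by simp
  next
    case (Suc k)
    have "{t. grid_index m t = n} = {t. grid_index m t \<le> Suc k} - {t. grid_index m t \<le> k}"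
      using Suc by auto
    then have "measure (expo r) {t. grid_index m t = n} = (1 - q ^ Suc (Suc k)) - (1 - q ^ Suc k)"
      using cdf by (simp only:, subst finite_measure_Diff) auto
    then show ?thesis using Suc by (simp add: algebra_simps)
  qed
qed

text \<open>
  Under the exponential law the grid index is geometric with ratio \<open>exp (- r / (m + 1))\<close>. This is
  what turns the exponential time of the continuous problem into the geometric time of the walk.
\<close>

lemma integral_expo_grid_index:
  fixes c :: "nat \<Rightarrow> complex" and m :: nat
  assumes r: "0 < r" and c: "\<And>n. norm (c n) \<le> 1"
  defines "q \<equiv> exp (- r / real (Suc m))"
  shows "(LINT t|expo r. c (grid_index m t)) = (1 - of_real q) * (\<Sum>n. of_real q ^ n * c n)"
proof -
  interpret prob_space "expo r" by (rule prob_space_expo[OF r])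
  have q: "0 < q" "q < 1" using r by (auto simp: q_def)
  define f :: "nat \<Rightarrow> real \<Rightarrow> complex" where
    "f n t = indicator {t. grid_index m t = n} t *\<^sub>R c n" for n t
  have int: "integrable (expo r) (f n)" for n
    unfolding f_def
    by (intro integrable_const_bound[where B = "norm (c n)"]) (auto simp: indicator_def)
  have "(LINT t|expo r. c (grid_index m t)) = (LINT t|expo r. (\<Sum>n. f n t))"
  proof (intro Bochner_Integration.integral_cong refl)
    fix t
    have "(\<Sum>n. f n t) = f (grid_index m t) t"
      by (subst suminf_finite[of "{grid_index m t}"]) (auto simp: f_def)
    then show "c (grid_index m t) = (\<Sum>n. f n t)" by (simp add: f_def)
  qed
  also have "\<dots> = (\<Sum>n. LINT t|expo r. f n t)"
  proof (rule integral_suminf[OF int])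
    show "AE t in expo r. summable (\<lambda>n. norm (f n t))"
    proof (intro AE_I2 summable_finite)
      fix t n assume "n \<notin> {grid_index m t}" then show "norm (f n t) = 0" by (auto simp: f_def)
    qed simp
    have "(LINT t|expo r. norm (f n t)) = (1 - q) * q ^ n * norm (c n)" for n
      using measure_expo_grid_index[OF r, of m n] by (simp add: f_def q_def)
    moreover have "summable (\<lambda>n. (1 - q) * q ^ n * norm (c n))"
    proof (rule summable_comparison_test')
      show "summable (\<lambda>n. (1 - q) * q ^ n)" using q by (intro summable_mult summable_geometric) auto
      show "norm ((1 - q) * q ^ n * norm (c n)) \<le> (1 - q) * q ^ n" for n
        using q c[of n] by (auto simp: abs_mult intro!: mult_right_le_one_le)
    qed
    ultimately show "summable (\<lambda>n. LINT t|expo r. norm (f n t))" by simp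
  qed
  also have "\<dots> = (\<Sum>n. (1 - of_real q) * (of_real q ^ n * c n))"
  proof (rule arg_cong[where f = suminf], rule ext)
    fix n
    have "integrable (expo r) (indicator {t. grid_index m t = n} :: real \<Rightarrow> real)"
      by (intro integrable_const_bound[where B = 1]) (auto simp: indicator_def)
    then have "(LINT t|expo r. f n t) = measure (expo r) {t. grid_index m t = n} *\<^sub>R c n"
      unfolding f_def by (subst integral_scaleR_left) auto
    then have "(LINT t|expo r. f n t) = ((1 - q) * q ^ n) *\<^sub>R c n"
      unfolding measure_expo_grid_index[OF r] q_def .
    then show "(LINT t|expo r. f n t) = (1 - of_real q) * (of_real q ^ n * c n)"
      by (simp add: scaleR_conv_of_real)
  qed
  also have "\<dots> = (1 - of_real q) * (\<Sum>n. of_real q ^ n * c n)"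
  proof (rule suminf_mult)
    show "summable (\<lambda>n. of_real q ^ n * c n)"
    proof (rule summable_comparison_test')
      show "summable (\<lambda>n. q ^ n)" using q by (intro summable_geometric) auto
      show "norm (of_real q ^ n * c n) \<le> q ^ n" for n
        using q c[of n] by (auto simp: norm_mult norm_power intro!: mult_right_le_one_le)
    qed
  qed
  finally show ?thesis .
qed

section \<open>Wiener-Hopf factorization of a random walk at a geometric time\<close>

definition psum :: "(nat \<Rightarrow> real) \<Rightarrow> nat \<Rightarrow> real" where
  "psum x n = (\<Sum>i<n. x i)"

lemma psum_0 [simp]: "psum x 0 = 0"
  by (simp add: psum_def)

lemma psum_shift: "psum (\<lambda>i. x (k + i)) j = psum x (k + j) - psum x k"
  by (induction j) (simp_all add: psum_def)

text \<open>Reading the steps backwards from time \<open>n\<close>: the duality that exchanges maxima and minima of a walk.\<close>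

lemma psum_reverse:
  assumes "j \<le> n"
  shows "psum (\<lambda>i. x (n - Suc i)) j = psum x n - psum x (n - j)"
  using assms
proof (induction j)
  case (Suc j)
  then have "psum x (n - j) = psum x (n - Suc j) + x (n - Suc j)"
    by (metis Suc_diff_Suc Suc_le_eq lessThan_Suc_atMost psum_def sum.lessThan_Suc)
  then show ?case using Suc by (simp add: psum_def)
qed simp

lemma psum_cong: "(\<And>i. i < n \<Longrightarrow> x i = y i) \<Longrightarrow> psum x n = psum y n"
  unfolding psum_def by (intro sum.cong) auto

text \<open>
  The condition says that \<open>k\<close> is a strict ascending ladder time of the walk. Its counterpart for the
  remaining path is \<open>below\<close>.
\<close>

definition ladder :: "real \<Rightarrow> nat \<Rightarrow> (nat \<Rightarrow> real) \<Rightarrow> complex" where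
  "ladder v k x = (if \<forall>j<k. psum x j < psum x k then iexp (v * psum x k) else 0)"

definition below :: "real \<Rightarrow> nat \<Rightarrow> (nat \<Rightarrow> real) \<Rightarrow> complex" where
  "below w l x = (if \<forall>j\<le>l. psum x j \<le> 0 then iexp (w * psum x l) else 0)"

lemma ladder_cong: "(\<And>i. i < k \<Longrightarrow> x i = y i) \<Longrightarrow> ladder v k x = ladder v k y"
proof -
  assume "\<And>i. i < k \<Longrightarrow> x i = y i"
  then have "psum x j = psum y j" if "j \<le> k" for j using that by (intro psum_cong) auto
  then show ?thesis unfolding ladder_def by auto
qed

lemma below_cong: "(\<And>i. i < l \<Longrightarrow> x i = y i) \<Longrightarrow> below w l x = below w l y"
proof -
  assume "\<And>i. i < l \<Longrightarrow> x i = y i"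
  then have "psum x j = psum y j" if "j \<le> l" for j using that by (intro psum_cong) auto
  then show ?thesis unfolding below_def by auto
qed

lemma norm_ladder: "norm (ladder v k x) \<le> 1"
  by (simp add: ladder_def)

lemma norm_below: "norm (below w l x) \<le> 1"
  by (simp add: below_def)

lemma psum_measurable:
  assumes [measurable]: "\<And>i. i < n \<Longrightarrow> (\<lambda>\<omega>. x \<omega> i) \<in> borel_measurable M"
  shows "(\<lambda>\<omega>. psum (x \<omega>) n) \<in> borel_measurable M"
  unfolding psum_def by (rule borel_measurable_sum) (use assms in auto)

lemma borel_measurable_iexp:
  fixes f :: "'a \<Rightarrow> real"
  assumes [measurable]: "f \<in> borel_measurable M"
  shows "(\<lambda>\<omega>. iexp (v * f \<omega>)) \<in> borel_measurable M"
  by measurable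

lemma ladder_measurable:
  assumes "\<And>i. i < n \<Longrightarrow> (\<lambda>\<omega>. x \<omega> i) \<in> borel_measurable M"
  shows "(\<lambda>\<omega>. ladder v n (x \<omega>)) \<in> borel_measurable M"
proof -
  have m: "(\<lambda>\<omega>. psum (x \<omega>) j) \<in> borel_measurable M" if "j \<le> n" for j
    using assms that by (intro psum_measurable) auto
  have "Measurable.pred M (\<lambda>\<omega>. \<forall>j\<in>{..<n}. psum (x \<omega>) j < psum (x \<omega>) n)"
    by (intro pred_intros_finite borel_measurable_pred_less m) auto
  then have pred: "Measurable.pred M (\<lambda>\<omega>. \<forall>j<n. psum (x \<omega>) j < psum (x \<omega>) n)"
    by (simp only: Ball_def lessThan_iff)
  show ?thesis
    unfolding ladder_def
    by (rule measurable_If[OF borel_measurable_iexp[OF m[OF order_refl]] measurable_const predE[OF pred]])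
      simp
qed

lemma below_measurable:
  assumes "\<And>i. i < n \<Longrightarrow> (\<lambda>\<omega>. x \<omega> i) \<in> borel_measurable M"
  shows "(\<lambda>\<omega>. below v n (x \<omega>)) \<in> borel_measurable M"
proof -
  have m: "(\<lambda>\<omega>. psum (x \<omega>) j) \<in> borel_measurable M" if "j \<le> n" for j
    using assms that by (intro psum_measurable) auto
  have "Measurable.pred M (\<lambda>\<omega>. \<forall>j\<in>{..n}. psum (x \<omega>) j \<le> 0)"
    unfolding not_less[symmetric]
    by (intro pred_intros_finite pred_intros_logic borel_measurable_pred_less m) auto
  then have pred: "Measurable.pred M (\<lambda>\<omega>. \<forall>j\<le>n. psum (x \<omega>) j \<le> 0)"
    by (simp only: Ball_def atMost_iff)
  show ?thesis
    unfolding below_def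
    by (rule measurable_If[OF borel_measurable_iexp[OF m[OF order_refl]] measurable_const predE[OF pred]])
      simp
qed

text \<open>
  Exactly one \<open>k \<le> n\<close> is the first time at which the maximum over \<open>{..n}\<close> is attained. For this
  \<open>k\<close> the walk makes a strict new maximum at \<open>k\<close> and afterwards never exceeds it; for every other
  \<open>k\<close> one of the two factors vanishes.
\<close>

lemma split_at_first_maximum:
  fixes x :: "nat \<Rightarrow> real" and n :: nat
  defines "S \<equiv> Max (psum x ` {..n})"
  shows "(\<Sum>k\<le>n. ladder v k x * below w (n - k) (\<lambda>i. x (k + i)))
           = iexp (v * S) * iexp (w * (psum x n - S))"
proof -
  have le: "psum x j \<le> S" if "j \<le> n" for j
    unfolding S_def using that by (intro Max_ge) auto
  have "S \<in> psum x ` {..n}" unfolding S_def by (intro Max_in) auto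
  then have ex: "\<exists>k. k \<le> n \<and> psum x k = S" by auto
  define k0 where "k0 = (LEAST k. k \<le> n \<and> psum x k = S)"
  have k0: "k0 \<le> n" "psum x k0 = S"
    using LeastI_ex[OF ex] by (auto simp: k0_def)
  have first: "psum x j < S" if "j < k0" for j
  proof -
    have "\<not> (j \<le> n \<and> psum x j = S)" using that unfolding k0_def by (rule not_less_Least)
    moreover have "j \<le> n" using that k0 by simp
    ultimately show ?thesis using le[of j] by simp
  qed
  have "ladder v k x * below w (n - k) (\<lambda>i. x (k + i))
        = (if k = k0 then iexp (v * S) * iexp (w * (psum x n - S)) else 0)" if k: "k \<le> n" for k
  proof (cases "k = k0")
    case True
    have "\<forall>j\<le>n - k0. psum (\<lambda>i. x (k0 + i)) j \<le> 0"
      using le k0 by (auto simp: psum_shift)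
    moreover have "psum (\<lambda>i. x (k0 + i)) (n - k0) = psum x n - S"
      using k0 by (simp add: psum_shift)
    ultimately show ?thesis
      using True k0 first by (simp add: ladder_def below_def)
  next
    case False
    then consider "k < k0" | "k0 < k" by linarith
    then have "ladder v k x = 0 \<or> below w (n - k) (\<lambda>i. x (k + i)) = 0"
    proof cases
      case 1
      have "psum (\<lambda>i. x (k + i)) (k0 - k) > 0"
        using 1 first[of k] k0 by (simp add: psum_shift)
      moreover have "k0 - k \<le> n - k" using k0 by simp
      ultimately have "\<not> (\<forall>j\<le>n - k. psum (\<lambda>i. x (k + i)) j \<le> 0)" by (meson not_less)
      then show ?thesis by (auto simp: below_def)
    next
      case 2
      then have "\<not> (\<forall>j<k. psum x j < psum x k)" using le[OF k] k0 by force
      then show ?thesis by (auto simp: ladder_def)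
    qed
    then show ?thesis using False by auto
  qed
  then have "(\<Sum>k\<le>n. ladder v k x * below w (n - k) (\<lambda>i. x (k + i)))
      = (\<Sum>k\<le>n. if k = k0 then iexp (v * S) * iexp (w * (psum x n - S)) else 0)"
    by (intro sum.cong) auto
  then show ?thesis using k0 by simp
qed

lemma Max_psum_reverse:
  "psum x n - Max (psum x ` {..n}) = Min (psum (\<lambda>i. x (n - Suc i)) ` {..n})" (is "_ = Min (psum ?y ` _)")
proof -
  have eq: "psum x ` {..n} = (\<lambda>j. psum x n - psum ?y j) ` {..n}"
  proof -
    have *: "psum x j = psum x n - psum ?y (n - j)" if "j \<in> {..n}" for j
      using that psum_reverse[of "n - j" n x] by simp
    have "psum x ` {..n} = (\<lambda>j. psum x n - psum ?y j) ` (\<lambda>j. n - j) ` {..n}"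
      unfolding image_image by (rule image_cong[OF refl *])
    moreover have "(\<lambda>j. n - j) ` {..n} = {..n}"
    proof (intro set_eqI iffI)
      fix j assume "j \<in> {..n}"
      then have "j = n - (n - j)" "n - j \<in> {..n}" by auto
      then show "j \<in> (\<lambda>j. n - j) ` {..n}" by blast
    qed auto
    ultimately show ?thesis by simp
  qed
  have "Min (psum ?y ` {..n}) \<in> psum ?y ` {..n}" by (intro Min_in) auto
  then obtain j where j: "j \<le> n" "Min (psum ?y ` {..n}) = psum ?y j" by (auto simp del: Min_in)
  \<comment> \<open>Reversal maps the times onto themselves and turns the maximum into a minimum.\<close>
  have "Max ((\<lambda>j. psum x n - psum ?y j) ` {..n}) = psum x n - psum ?y j"
  proof (intro Max_eqI)
    show "psum x n - psum ?y j \<in> (\<lambda>j. psum x n - psum ?y j) ` {..n}" using j by blast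
    fix z assume "z \<in> (\<lambda>j. psum x n - psum ?y j) ` {..n}"
    then obtain i where "i \<le> n" "z = psum x n - psum ?y i" by auto
    then show "z \<le> psum x n - psum ?y j" using Min_le[of "psum ?y ` {..n}" "psum ?y i"] j by auto
  qed simp
  then show ?thesis unfolding eq j by simp
qed

locale iid_sequence = prob_space M for M :: "'a measure" +
  fixes D :: "nat \<Rightarrow> 'a \<Rightarrow> real"
  assumes indep: "indep_vars (\<lambda>_. borel) D UNIV"
    and same_law: "distr M borel (D i) = distr M borel (D 0)"
begin

lemma D_measurable [measurable]: "D i \<in> borel_measurable M"
  using indep by (auto simp: indep_vars_def2)

text \<open>The selections needed are shifts, for the part of a path after its maximum, and reversals.\<close>

lemma law_reindex:
  fixes f :: "nat \<Rightarrow> nat"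
  assumes "inj_on f {..<n}"
  shows "distr M (\<Pi>\<^sub>M i\<in>{..<n}. borel) (\<lambda>\<omega>. \<lambda>i\<in>{..<n}. D (f i) \<omega>)
         = (\<Pi>\<^sub>M i\<in>{..<n}. distr M borel (D 0))"
proof -
  let ?\<mu> = "distr M borel (D 0)"
  have law: "distr M (\<Pi>\<^sub>M i\<in>UNIV. borel) (\<lambda>\<omega>. \<lambda>i\<in>UNIV. D i \<omega>) = (\<Pi>\<^sub>M i\<in>UNIV. ?\<mu>)"
  proof -
    have "distr M (\<Pi>\<^sub>M i\<in>UNIV. borel) (\<lambda>\<omega>. \<lambda>i\<in>UNIV. D i \<omega>) = (\<Pi>\<^sub>M i\<in>UNIV. distr M borel (D i))"
      by (rule indep_vars_iff_distr_eq_PiM[THEN iffD1, OF _ _ indep]) (rule UNIV_not_empty D_measurable)+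
    also have "\<dots> = (\<Pi>\<^sub>M i\<in>UNIV. ?\<mu>)" by (rule PiM_cong[OF refl same_law])
    finally show ?thesis .
  qed
  have [measurable]: "(\<lambda>x. \<lambda>i\<in>{..<n}. x (f i)) \<in> (\<Pi>\<^sub>M i\<in>UNIV. borel) \<rightarrow>\<^sub>M (\<Pi>\<^sub>M i\<in>{..<n}. (borel :: real measure))"
    by (intro measurable_restrict) auto
  have "distr M (\<Pi>\<^sub>M i\<in>{..<n}. borel) (\<lambda>\<omega>. \<lambda>i\<in>{..<n}. D (f i) \<omega>)
      = distr (distr M (\<Pi>\<^sub>M i\<in>UNIV. borel) (\<lambda>\<omega>. \<lambda>i\<in>UNIV. D i \<omega>)) (\<Pi>\<^sub>M i\<in>{..<n}. borel) (\<lambda>x. \<lambda>i\<in>{..<n}. x (f i))"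
    by (subst distr_distr) (auto simp: comp_def intro!: measurable_restrict)
  also have "\<dots> = distr (\<Pi>\<^sub>M i\<in>UNIV. ?\<mu>) (\<Pi>\<^sub>M i\<in>{..<n}. ?\<mu>) (\<lambda>x. \<lambda>i\<in>{..<n}. x (f i))"
    unfolding law by (intro distr_cong sets_PiM_cong) auto
  also have "\<dots> = (\<Pi>\<^sub>M i\<in>{..<n}. ?\<mu>)"
    using assms by (intro distr_PiM_reindex) (auto intro: prob_space_distr)
  finally show ?thesis .
qed

lemma expectation_reindex:
  fixes f :: "nat \<Rightarrow> nat" and \<Phi> :: "(nat \<Rightarrow> real) \<Rightarrow> complex"
  assumes f: "inj_on f {..<n}"
    and \<Phi>: "\<Phi> \<in> borel_measurable (\<Pi>\<^sub>M i\<in>{..<n}. borel)"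
    and \<Phi>_cong: "\<And>x y. (\<And>i. i < n \<Longrightarrow> x i = y i) \<Longrightarrow> \<Phi> x = \<Phi> y"
  shows "expectation (\<lambda>\<omega>. \<Phi> (\<lambda>i. D (f i) \<omega>)) = expectation (\<lambda>\<omega>. \<Phi> (\<lambda>i. D i \<omega>))"
proof -
  have *: "expectation (\<lambda>\<omega>. \<Phi> (\<lambda>i. D (h i) \<omega>)) = integral\<^sup>L (\<Pi>\<^sub>M i\<in>{..<n}. distr M borel (D 0)) \<Phi>"
    if "inj_on h {..<n}" for h
  proof -
    have "expectation (\<lambda>\<omega>. \<Phi> (\<lambda>i. D (h i) \<omega>)) = expectation (\<lambda>\<omega>. \<Phi> (\<lambda>i\<in>{..<n}. D (h i) \<omega>))"
      by (intro Bochner_Integration.integral_cong refl \<Phi>_cong) auto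
    also have "\<dots> = integral\<^sup>L (distr M (\<Pi>\<^sub>M i\<in>{..<n}. borel) (\<lambda>\<omega>. \<lambda>i\<in>{..<n}. D (h i) \<omega>)) \<Phi>"
      by (subst integral_distr[OF _ \<Phi>]) (auto intro!: measurable_restrict)
    finally show ?thesis by (simp only: law_reindex[OF that])
  qed
  show ?thesis using *[OF f] *[of "\<lambda>i. i"] by simp
qed

lemma expectation_ladder_below:
  "expectation (\<lambda>\<omega>. ladder v k (\<lambda>i. D i \<omega>) * below w l (\<lambda>i. D (k + i) \<omega>))
   = expectation (\<lambda>\<omega>. ladder v k (\<lambda>i. D i \<omega>)) * expectation (\<lambda>\<omega>. below w l (\<lambda>i. D i \<omega>))"
proof -
  have [measurable]: "ladder v k \<in> borel_measurable (\<Pi>\<^sub>M i\<in>{..<k}. borel)"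
    by (rule ladder_measurable[of k "\<lambda>x. x"]) auto
  have b1 [measurable]: "below w l \<in> borel_measurable (\<Pi>\<^sub>M i\<in>{..<l}. borel)"
    by (rule below_measurable[of l "\<lambda>x. x"]) auto
  have [measurable]: "(\<lambda>x. below w l (\<lambda>i. x (k + i))) \<in> borel_measurable (\<Pi>\<^sub>M i\<in>{k..<k+l}. borel)"
    by (rule below_measurable) auto
  have "indep_var borel (ladder v k \<circ> (\<lambda>\<omega>. \<lambda>i\<in>{..<k}. D i \<omega>))
      borel ((\<lambda>x. below w l (\<lambda>i. x (k + i))) \<circ> (\<lambda>\<omega>. \<lambda>i\<in>{k..<k+l}. D i \<omega>))"
    by (rule indep_var_compose[OF indep_var_restrict[OF indep]]) auto
  moreover have "ladder v k \<circ> (\<lambda>\<omega>. \<lambda>i\<in>{..<k}. D i \<omega>) = (\<lambda>\<omega>. ladder v k (\<lambda>i. D i \<omega>))"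
    unfolding comp_def by (intro ext ladder_cong) auto
  moreover have "(\<lambda>x. below w l (\<lambda>i. x (k + i))) \<circ> (\<lambda>\<omega>. \<lambda>i\<in>{k..<k+l}. D i \<omega>)
      = (\<lambda>\<omega>. below w l (\<lambda>i. D (k + i) \<omega>))"
    unfolding comp_def by (intro ext below_cong) auto
  ultimately have ind: "indep_var borel (\<lambda>\<omega>. ladder v k (\<lambda>i. D i \<omega>)) borel (\<lambda>\<omega>. below w l (\<lambda>i. D (k + i) \<omega>))"
    by simp
  have "integrable M (\<lambda>\<omega>. ladder v k (\<lambda>i. D i \<omega>))"
    by (intro integrable_const_bound[where B = 1] AE_I2 norm_ladder ladder_measurable D_measurable)
  moreover have "integrable M (\<lambda>\<omega>. below w l (\<lambda>i. D (k + i) \<omega>))"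
    by (intro integrable_const_bound[where B = 1] AE_I2 norm_below below_measurable D_measurable)
  moreover have "expectation (\<lambda>\<omega>. below w l (\<lambda>i. D (k + i) \<omega>)) = expectation (\<lambda>\<omega>. below w l (\<lambda>i. D i \<omega>))"
    by (rule expectation_reindex[OF _ b1 below_cong]) (auto simp: inj_on_def)
  ultimately show ?thesis using indep_var_lebesgue_integral[OF ind] by simp
qed

text \<open>
  The path up to its first maximum and the path after it use disjoint blocks of steps, so the two
  factors are independent. The right-hand side is a convolution in \<open>n\<close>; the free choice of \<open>v\<close> and
  \<open>w\<close> gives four such identities at once.
\<close>

lemma expectation_split_at_first_maximum:
  fixes v w :: real and n :: nat
  defines "S \<equiv> \<lambda>\<omega>. Max (psum (\<lambda>i. D i \<omega>) ` {..n})"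
  shows "expectation (\<lambda>\<omega>. iexp (v * S \<omega>) * iexp (w * (psum (\<lambda>i. D i \<omega>) n - S \<omega>)))
    = (\<Sum>k\<le>n. expectation (\<lambda>\<omega>. ladder v k (\<lambda>i. D i \<omega>)) * expectation (\<lambda>\<omega>. below w (n - k) (\<lambda>i. D i \<omega>)))"
proof -
  have "expectation (\<lambda>\<omega>. iexp (v * S \<omega>) * iexp (w * (psum (\<lambda>i. D i \<omega>) n - S \<omega>)))
      = expectation (\<lambda>\<omega>. \<Sum>k\<le>n. ladder v k (\<lambda>i. D i \<omega>) * below w (n - k) (\<lambda>i. D (k + i) \<omega>))"
    unfolding S_def split_at_first_maximum[symmetric] ..
  also have "\<dots> = (\<Sum>k\<le>n. expectation (\<lambda>\<omega>. ladder v k (\<lambda>i. D i \<omega>) * below w (n - k) (\<lambda>i. D (k + i) \<omega>)))"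
  proof (rule Bochner_Integration.integral_sum)
    show "integrable M (\<lambda>\<omega>. ladder v k (\<lambda>i. D i \<omega>) * below w (n - k) (\<lambda>i. D (k + i) \<omega>))" for k
      by (intro integrable_const_bound[where B = 1] AE_I2 borel_measurable_times
          ladder_measurable below_measurable D_measurable)
        (auto simp: norm_mult intro!: mult_le_one norm_ladder norm_below)
  qed
  finally show ?thesis by (simp only: expectation_ladder_below)
qed

lemma expectation_iexp_reverse:
  "expectation (\<lambda>\<omega>. iexp (w * (psum (\<lambda>i. D i \<omega>) n - Max (psum (\<lambda>i. D i \<omega>) ` {..n}))))
   = expectation (\<lambda>\<omega>. iexp (w * Min (psum (\<lambda>i. D i \<omega>) ` {..n})))"
proof -
  let ?\<Phi> = "\<lambda>x. iexp (w * Min (psum x ` {..n}))"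
  have [measurable]: "(\<lambda>x. psum x j) \<in> borel_measurable (\<Pi>\<^sub>M i\<in>{..<n}. borel)" if "j \<in> {..n}" for j
    by (rule psum_measurable) (use that in auto)
  have meas: "?\<Phi> \<in> borel_measurable (\<Pi>\<^sub>M i\<in>{..<n}. borel)"
    by measurable
  have cong: "?\<Phi> x = ?\<Phi> y" if "\<And>i. i < n \<Longrightarrow> x i = y i" for x y
  proof -
    have "psum x ` {..n} = psum y ` {..n}" using that by (intro image_cong refl psum_cong) auto
    then show ?thesis by simp
  qed
  have inj: "inj_on (\<lambda>i. n - Suc i) {..<n}" by (auto simp: inj_on_def)
  have "expectation (\<lambda>\<omega>. ?\<Phi> (\<lambda>i. D (n - Suc i) \<omega>)) = expectation (\<lambda>\<omega>. ?\<Phi> (\<lambda>i. D i \<omega>))"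
    by (rule expectation_reindex[OF inj meas cong])
  then show ?thesis by (simp only: Max_psum_reverse)
qed

text \<open>
  Let \<open>W\<close> be the position and \<open>S\<close> the maximum of the walk at time \<open>n\<close>, and let \<open>J v w n\<close> be the
  joint transform of \<open>S\<close> and \<open>W - S\<close>. By the convolution identity, \<open>\<Sum>n. q ^ n * J v w n\<close> is a
  product \<open>a v * b w\<close>. A product \<open>f v w = a v * b w\<close> always satisfies
  \<open>f u u * f 0 0 = f u 0 * f 0 u\<close>, and the normalized value at \<open>(0, 0)\<close> is \<open>1\<close>. Finally \<open>W - S\<close>
  has the law of the minimum by reversal.
\<close>

theorem Wiener_Hopf_geometric:
  fixes u q :: real
  assumes q: "0 \<le> q" "q < 1"
  defines "geo \<equiv> \<lambda>c :: nat \<Rightarrow> complex. (1 - of_real q) * (\<Sum>n. of_real q ^ n * c n)"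
  shows "geo (\<lambda>n. expectation (\<lambda>\<omega>. iexp (u * psum (\<lambda>i. D i \<omega>) n)))
    = geo (\<lambda>n. expectation (\<lambda>\<omega>. iexp (u * Max (psum (\<lambda>i. D i \<omega>) ` {..n}))))
    * geo (\<lambda>n. expectation (\<lambda>\<omega>. iexp (u * Min (psum (\<lambda>i. D i \<omega>) ` {..n}))))"
proof -
  define L where "L v n = expectation (\<lambda>\<omega>. ladder v n (\<lambda>i. D i \<omega>))" for v n
  define B where "B w n = expectation (\<lambda>\<omega>. below w n (\<lambda>i. D i \<omega>))" for w n
  define a where "a v n = of_real q ^ n * L v n" for v n
  define b where "b w n = of_real q ^ n * B w n" for w n
  define J where "J v w n = expectation (\<lambda>\<omega>. iexp (v * Max (psum (\<lambda>i. D i \<omega>) ` {..n}))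
      * iexp (w * (psum (\<lambda>i. D i \<omega>) n - Max (psum (\<lambda>i. D i \<omega>) ` {..n}))))" for v w n
  have bound: "norm (expectation f) \<le> 1" if "\<And>\<omega>. norm (f \<omega>) \<le> 1" for f :: "'a \<Rightarrow> complex"
  proof (cases "integrable M f")
    case True
    have "norm (expectation f) \<le> expectation (\<lambda>\<omega>. norm (f \<omega>))" by (rule integral_norm_bound)
    also have "\<dots> \<le> 1" using True that by (intro integral_le_const) auto
    finally show ?thesis .
  qed (simp add: not_integrable_integral_eq)
  have summ: "summable (\<lambda>n. norm (of_real q ^ n * c n))" if "\<And>n. norm (c n) \<le> 1" for c :: "nat \<Rightarrow> complex"
  proof (rule summable_comparison_test')
    show "summable (\<lambda>n. q ^ n)" using q by (intro summable_geometric) auto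
    show "norm (norm (of_real q ^ n * c n)) \<le> q ^ n" for n
      using q that[of n] by (auto simp: norm_mult norm_power intro!: mult_right_le_one_le)
  qed
  have sa: "summable (\<lambda>n. norm (a v n))" for v
    unfolding a_def L_def by (intro summ bound norm_ladder)
  have sb: "summable (\<lambda>n. norm (b w n))" for w
    unfolding b_def B_def by (intro summ bound norm_below)
  have geoJ: "geo (J v w) = (1 - of_real q) * ((\<Sum>n. a v n) * (\<Sum>n. b w n))" for v w
  proof -
    have "of_real q ^ n * J v w n = (\<Sum>k\<le>n. a v k * b w (n - k))" for n
    proof -
      have "J v w n = (\<Sum>k\<le>n. L v k * B w (n - k))"
        unfolding J_def L_def B_def by (rule expectation_split_at_first_maximum)
      moreover have "of_real q ^ n * (L v k * B w (n - k)) = a v k * b w (n - k)" if "k \<le> n" for k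
      proof -
        have "(of_real q :: complex) ^ n = of_real q ^ k * of_real q ^ (n - k)"
          using that by (simp flip: power_add)
        then show ?thesis by (simp add: a_def b_def)
      qed
      ultimately show ?thesis by (simp add: sum_distrib_left)
    qed
    then show ?thesis
      using Cauchy_product_sums[OF sa sb, of v w] unfolding geo_def by (simp add: sums_iff)
  qed
  have norm1: "geo (J 0 0) = 1"
  proof -
    have "J 0 0 n = 1" for n by (simp add: J_def prob_space)
    moreover have "(\<Sum>n. (of_real q :: complex) ^ n) = 1 / (1 - of_real q)"
      using q by (intro suminf_geometric) auto
    moreover have "(1 - of_real q :: complex) \<noteq> 0"
      using q by (simp add: complex_eq_iff)
    ultimately show ?thesis by (simp add: geo_def)
  qed
  have J: "expectation (\<lambda>\<omega>. iexp (u * psum (\<lambda>i. D i \<omega>) n)) = J u u n"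
    "expectation (\<lambda>\<omega>. iexp (u * Max (psum (\<lambda>i. D i \<omega>) ` {..n}))) = J u 0 n"
    "expectation (\<lambda>\<omega>. iexp (u * Min (psum (\<lambda>i. D i \<omega>) ` {..n}))) = J 0 u n" for n
    unfolding expectation_iexp_reverse[symmetric] J_def
    by (simp_all flip: exp_add add: algebra_simps)
  \<comment> \<open>Exchange the second factors of \<open>geo (J u u)\<close> and \<open>geo (J 0 0)\<close>.\<close>
  have "geo (J u u) = geo (J u u) * geo (J 0 0)" by (simp only: norm1 mult_1_right)
  also have "\<dots> = geo (J u 0) * geo (J 0 u)" by (simp add: geoJ algebra_simps)
  finally show ?thesis unfolding J .
qed

end

section \<open>Increasing functions of independent variables are positively correlated\<close>

text \<open>Integrate \<open>(f x - f y) * (h x - h y) \<ge> 0\<close> over two independent copies.\<close>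

lemma (in prob_space) Chebyshev_association:
  fixes f h :: "'a \<Rightarrow> real"
  assumes f [measurable]: "f \<in> borel_measurable M" and h [measurable]: "h \<in> borel_measurable M"
    and bf: "\<And>x. x \<in> space M \<Longrightarrow> \<bar>f x\<bar> \<le> B" and bh: "\<And>x. x \<in> space M \<Longrightarrow> \<bar>h x\<bar> \<le> C"
    and comonotone: "\<And>x y. x \<in> space M \<Longrightarrow> y \<in> space M \<Longrightarrow> 0 \<le> (f x - f y) * (h x - h y)"
  shows "expectation f * expectation h \<le> expectation (\<lambda>x. f x * h x)"
proof -
  have [simp]: "integrable M f" "integrable M h"
    using bf bh
    by (auto intro!: integrable_const_bound[where f = f and B = B] integrable_const_bound[where f = h and B = C])
  have [simp]: "integrable M (\<lambda>x. f x * h x)"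
    using bf bh
    by (intro integrable_const_bound[where B = "B * C"] AE_I2)
      (auto simp: abs_mult intro!: mult_mono intro: order_trans[OF abs_ge_zero])
  let ?F = "expectation f" and ?H = "expectation h" and ?K = "expectation (\<lambda>x. f x * h x)"
  have inner: "expectation (\<lambda>y. (f x - f y) * (h x - h y)) = f x * h x - f x * ?H - ?F * h x + ?K" for x
  proof -
    have "(\<lambda>y. (f x - f y) * (h x - h y)) = (\<lambda>y. f x * h x - f x * h y - f y * h x + f y * h y)"
      by (auto simp: algebra_simps)
    then show ?thesis by (simp add: prob_space)
  qed
  have "0 \<le> expectation (\<lambda>x. expectation (\<lambda>y. (f x - f y) * (h x - h y)))"
    by (intro integral_nonneg_AE AE_I2 comonotone)
  also have "\<dots> = 2 * (?K - ?F * ?H)"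
    unfolding inner by (simp add: prob_space)
  finally show ?thesis by simp
qed

text \<open>
  Induction on the number of coordinates: for fixed other coordinates the one-variable inequality
  applies, and the partial averages are again increasing functions of the remaining coordinates.
\<close>

lemma Harris_inequality:
  fixes N :: "'i \<Rightarrow> real measure" and f h :: "('i \<Rightarrow> real) \<Rightarrow> real"
  assumes "finite I"
    and N: "\<And>i. prob_space (N i)" "\<And>i. sets (N i) = sets borel"
    and "f \<in> borel_measurable (Pi\<^sub>M I N)" "h \<in> borel_measurable (Pi\<^sub>M I N)"
    and "\<And>x. x \<in> space (Pi\<^sub>M I N) \<Longrightarrow> \<bar>f x\<bar> \<le> B" "\<And>x. x \<in> space (Pi\<^sub>M I N) \<Longrightarrow> \<bar>h x\<bar> \<le> C"
    and "\<And>x y. x \<in> space (Pi\<^sub>M I N) \<Longrightarrow> y \<in> space (Pi\<^sub>M I N) \<Longrightarrow> (\<And>i. i \<in> I \<Longrightarrow> x i \<le> y i) \<Longrightarrow> f x \<le> f y"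
    and "\<And>x y. x \<in> space (Pi\<^sub>M I N) \<Longrightarrow> y \<in> space (Pi\<^sub>M I N) \<Longrightarrow> (\<And>i. i \<in> I \<Longrightarrow> x i \<le> y i) \<Longrightarrow> h x \<le> h y"
  shows "integral\<^sup>L (Pi\<^sub>M I N) f * integral\<^sup>L (Pi\<^sub>M I N) h \<le> (\<integral>x. f x * h x \<partial>Pi\<^sub>M I N)"
  using assms(1,4-)
proof (induction I arbitrary: f h rule: finite_induct)
  case empty
  interpret prob_space "Pi\<^sub>M {} N" by (rule prob_space_PiM) (use N in auto)
  show ?case
  proof (rule Chebyshev_association[OF empty(1-4)])
    fix x y assume "x \<in> space (Pi\<^sub>M {} N)" "y \<in> space (Pi\<^sub>M {} N)"
    then have "x = y" by (simp add: space_PiM)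
    then show "0 \<le> (f x - f y) * (h x - h y)" by simp
  qed
next
  case (insert i I)
  interpret prob_space "N j" for j by (rule N)
  interpret product_sigma_finite N ..
  interpret I: prob_space "Pi\<^sub>M I N" by (rule prob_space_PiM) (rule N)
  interpret J: prob_space "Pi\<^sub>M (insert i I) N" by (rule prob_space_PiM) (rule N)
  have sp: "x(i := y) \<in> space (Pi\<^sub>M (insert i I) N)" if "x \<in> space (Pi\<^sub>M I N)" for x y
    using that sets_eq_imp_space_eq[OF N(2)] by (auto simp: space_PiM PiE_iff extensional_def)
  have sec: "(\<lambda>y. \<phi> (x(i := y))) \<in> borel_measurable (N i)"
    if "\<phi> \<in> borel_measurable (Pi\<^sub>M (insert i I) N)" "x \<in> space (Pi\<^sub>M I N)" for \<phi> :: "('i \<Rightarrow> real) \<Rightarrow> real" and x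
    using that insert.hyps
    by (intro measurable_compose[OF measurable_component_update[of x I N i] that(1)])
  have avg: "(\<lambda>x. \<integral>y. \<phi> (x(i := y)) \<partial>N i) \<in> borel_measurable (Pi\<^sub>M I N)"
    if [measurable]: "\<phi> \<in> borel_measurable (Pi\<^sub>M (insert i I) N)" for \<phi> :: "('i \<Rightarrow> real) \<Rightarrow> real"
  proof -
    have "(\<lambda>(x, y). \<phi> (x(i := y))) \<in> borel_measurable (Pi\<^sub>M I N \<Otimes>\<^sub>M N i)"
      using measurable_compose[OF measurable_add_dim that] by (simp add: split_def)
    then show ?thesis by (intro borel_measurable_lebesgue_integral) simp
  qed
  have int: "integrable (N i) (\<lambda>y. \<phi> (x(i := y)))"
    if "\<phi> \<in> borel_measurable (Pi\<^sub>M (insert i I) N)" "x \<in> space (Pi\<^sub>M I N)"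
      "\<And>x. x \<in> space (Pi\<^sub>M (insert i I) N) \<Longrightarrow> \<bar>\<phi> x\<bar> \<le> A"
    for \<phi> :: "('i \<Rightarrow> real) \<Rightarrow> real" and x A
    using that by (intro integrable_const_bound[where B = A] sec AE_I2) (auto intro: sp)
  have split: "integral\<^sup>L (Pi\<^sub>M (insert i I) N) \<phi> = (\<integral>x. (\<integral>y. \<phi> (x(i := y)) \<partial>N i) \<partial>Pi\<^sub>M I N)"
    if "\<phi> \<in> borel_measurable (Pi\<^sub>M (insert i I) N)"
      "\<And>x. x \<in> space (Pi\<^sub>M (insert i I) N) \<Longrightarrow> \<bar>\<phi> x\<bar> \<le> A"
    for \<phi> :: "('i \<Rightarrow> real) \<Rightarrow> real" and A
    using that insert.hyps
    by (intro product_integral_insert J.integrable_const_bound[where B = A]) auto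
  have bound: "\<bar>\<integral>y. \<phi> (x(i := y)) \<partial>N i\<bar> \<le> A"
    if "\<phi> \<in> borel_measurable (Pi\<^sub>M (insert i I) N)" "x \<in> space (Pi\<^sub>M I N)"
      "\<And>x. x \<in> space (Pi\<^sub>M (insert i I) N) \<Longrightarrow> \<bar>\<phi> x\<bar> \<le> A"
    for \<phi> :: "('i \<Rightarrow> real) \<Rightarrow> real" and x A
  proof -
    have "\<bar>\<integral>y. \<phi> (x(i := y)) \<partial>N i\<bar> \<le> (\<integral>y. \<bar>\<phi> (x(i := y))\<bar> \<partial>N i)" by (rule integral_abs_bound)
    also have "\<dots> \<le> A"
      using int[OF that] that by (intro integral_le_const AE_I2 integrable_abs) (auto intro: sp)
    finally show ?thesis .
  qed
  have mono: "(\<integral>y. \<phi> (x(i := y)) \<partial>N i) \<le> (\<integral>y. \<phi> (z(i := y)) \<partial>N i)"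
    if "\<phi> \<in> borel_measurable (Pi\<^sub>M (insert i I) N)"
      "\<And>x. x \<in> space (Pi\<^sub>M (insert i I) N) \<Longrightarrow> \<bar>\<phi> x\<bar> \<le> A"
      "\<And>x y. x \<in> space (Pi\<^sub>M (insert i I) N) \<Longrightarrow> y \<in> space (Pi\<^sub>M (insert i I) N) \<Longrightarrow>
         (\<And>j. j \<in> insert i I \<Longrightarrow> x j \<le> y j) \<Longrightarrow> \<phi> x \<le> \<phi> y"
      "x \<in> space (Pi\<^sub>M I N)" "z \<in> space (Pi\<^sub>M I N)" "\<And>j. j \<in> I \<Longrightarrow> x j \<le> z j"
    for \<phi> :: "('i \<Rightarrow> real) \<Rightarrow> real" and x z A
    using int[OF that(1,4,2)] int[OF that(1,5,2)] that(6)
    by (intro integral_mono that(3) sp that(4,5)) auto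
  have bfh: "\<bar>f x * h x\<bar> \<le> B * C" if "x \<in> space (Pi\<^sub>M (insert i I) N)" for x
    using insert.prems(3)[OF that] insert.prems(4)[OF that]
    by (auto simp: abs_mult intro!: mult_mono intro: order_trans[OF abs_ge_zero])
  have mfh: "(\<lambda>x. f x * h x) \<in> borel_measurable (Pi\<^sub>M (insert i I) N)"
    using insert.prems(1,2) by measurable
  have "integral\<^sup>L (Pi\<^sub>M (insert i I) N) f * integral\<^sup>L (Pi\<^sub>M (insert i I) N) h
      = (\<integral>x. (\<integral>y. f (x(i := y)) \<partial>N i) \<partial>Pi\<^sub>M I N) * (\<integral>x. (\<integral>y. h (x(i := y)) \<partial>N i) \<partial>Pi\<^sub>M I N)"
    by (simp only: split[OF insert.prems(1,3)] split[OF insert.prems(2,4)])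
  also have "\<dots> \<le> (\<integral>x. (\<integral>y. f (x(i := y)) \<partial>N i) * (\<integral>y. h (x(i := y)) \<partial>N i) \<partial>Pi\<^sub>M I N)"
    by (rule insert.IH)
      (blast intro: avg insert.prems(1,2) bound[OF insert.prems(1) _ insert.prems(3)]
        bound[OF insert.prems(2) _ insert.prems(4)] mono[OF insert.prems(1,3,5)] mono[OF insert.prems(2,4,6)])+
  also have "\<dots> \<le> (\<integral>x. (\<integral>y. f (x(i := y)) * h (x(i := y)) \<partial>N i) \<partial>Pi\<^sub>M I N)"
  proof (rule integral_mono)
    show "integrable (Pi\<^sub>M I N) (\<lambda>x. (\<integral>y. f (x(i := y)) \<partial>N i) * (\<integral>y. h (x(i := y)) \<partial>N i))"
    proof (intro I.integrable_const_bound[where B = "B * C"] AE_I2 borel_measurable_times avg insert.prems)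
      fix x assume x: "x \<in> space (Pi\<^sub>M I N)"
      note b = bound[OF insert.prems(1) x insert.prems(3)] bound[OF insert.prems(2) x insert.prems(4)]
      show "norm ((\<integral>y. f (x(i := y)) \<partial>N i) * (\<integral>y. h (x(i := y)) \<partial>N i)) \<le> B * C"
        unfolding real_norm_def abs_mult
        by (rule mult_mono[OF b order_trans[OF abs_ge_zero b(1)] abs_ge_zero])
    qed
    show "integrable (Pi\<^sub>M I N) (\<lambda>x. \<integral>y. f (x(i := y)) * h (x(i := y)) \<partial>N i)"
      by (intro I.integrable_const_bound[where B = "B * C"] AE_I2 avg[OF mfh])
        (unfold real_norm_def, rule bound[OF mfh _ bfh])
  next
    fix x assume x: "x \<in> space (Pi\<^sub>M I N)"
    show "(\<integral>y. f (x(i := y)) \<partial>N i) * (\<integral>y. h (x(i := y)) \<partial>N i) \<le> (\<integral>y. f (x(i := y)) * h (x(i := y)) \<partial>N i)"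
    proof (rule Chebyshev_association)
      fix y z
      have "f (x(i := y)) \<le> f (x(i := z)) \<and> h (x(i := y)) \<le> h (x(i := z))" if "y \<le> z" for y z
        using that by (intro conjI insert.prems(5,6) sp x) auto
      then show "0 \<le> (f (x(i := y)) - f (x(i := z))) * (h (x(i := y)) - h (x(i := z)))"
        by (cases "y \<le> z") (auto intro: mult_nonpos_nonpos)
    qed (use x in \<open>auto intro!: sec sp insert.prems\<close>)
  qed
  also have "\<dots> = (\<integral>x. f x * h x \<partial>Pi\<^sub>M (insert i I) N)"
    by (simp only: split[OF mfh bfh])
  finally show ?case .
qed

lemma (in iid_sequence) increments_associated:
  fixes f h :: "(nat \<Rightarrow> real) \<Rightarrow> real" and n :: nat
  assumes f: "f \<in> borel_measurable (\<Pi>\<^sub>M i\<in>{..<n}. borel)" and h: "h \<in> borel_measurable (\<Pi>\<^sub>M i\<in>{..<n}. borel)"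
    and bounded: "\<And>x. \<bar>f x\<bar> \<le> B" "\<And>x. \<bar>h x\<bar> \<le> C"
    and mono: "\<And>x y. (\<And>i. i < n \<Longrightarrow> x i \<le> y i) \<Longrightarrow> f x \<le> f y"
      "\<And>x y. (\<And>i. i < n \<Longrightarrow> x i \<le> y i) \<Longrightarrow> h x \<le> h y"
  shows "expectation (\<lambda>\<omega>. f (\<lambda>i. D i \<omega>)) * expectation (\<lambda>\<omega>. h (\<lambda>i. D i \<omega>))
    \<le> expectation (\<lambda>\<omega>. f (\<lambda>i. D i \<omega>) * h (\<lambda>i. D i \<omega>))"
proof -
  let ?P = "\<Pi>\<^sub>M i\<in>{..<n}. distr M borel (D 0)"
  have sets_P: "sets ?P = sets (\<Pi>\<^sub>M i\<in>{..<n}. borel)" by (intro sets_PiM_cong) auto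
  have law: "distr M (\<Pi>\<^sub>M i\<in>{..<n}. borel) (\<lambda>\<omega>. \<lambda>i\<in>{..<n}. D i \<omega>) = ?P"
    using law_reindex[of "\<lambda>i. i"] by simp
  have *: "expectation (\<lambda>\<omega>. \<phi> (\<lambda>i. D i \<omega>)) = integral\<^sup>L ?P \<phi>"
    if "\<phi> \<in> borel_measurable (\<Pi>\<^sub>M i\<in>{..<n}. borel)" "\<And>x. \<phi> (\<lambda>i\<in>{..<n}. x i) = \<phi> x" for \<phi> :: "(nat \<Rightarrow> real) \<Rightarrow> real"
    unfolding law[symmetric]
    by (subst integral_distr) (auto intro!: measurable_restrict that simp: that(2))
  have f_cong: "f (\<lambda>i\<in>{..<n}. x i) = f x" and h_cong: "h (\<lambda>i\<in>{..<n}. x i) = h x" for x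
    by (auto intro!: antisym mono)
  have "integral\<^sup>L ?P f * integral\<^sup>L ?P h \<le> (\<integral>x. f x * h x \<partial>?P)"
    using f h bounded
    by (intro Harris_inequality mono prob_space_distr) (auto simp: measurable_cong_sets[OF sets_P refl])
  then show ?thesis
    using f h by (subst (1 2 3) *) (auto simp: f_cong h_cong)
qed

section \<open>Wiener-Hopf factorization of a Levy process at an exponential time\<close>

lemma time_indexed_measurable:
  fixes Z :: "nat \<Rightarrow> 'a \<Rightarrow> 'c :: topological_space"
  assumes "\<And>n. Z n \<in> borel_measurable N"
  shows "(\<lambda>p. Z (grid_index m (snd p)) (fst p)) \<in> borel_measurable (N \<Otimes>\<^sub>M borel)"
proof (rule measurable_compose_countable)
  show "(\<lambda>p. grid_index m (snd p)) \<in> N \<Otimes>\<^sub>M borel \<rightarrow>\<^sub>M count_space UNIV"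
    by (rule measurable_compose[OF measurable_snd grid_index_measurable])
  show "(\<lambda>p. Z n (fst p)) \<in> borel_measurable (N \<Otimes>\<^sub>M borel)" for n
    by (rule measurable_compose[OF measurable_fst assms])
qed

lemma time_indexed_limit_measurable:
  fixes Z :: "nat \<Rightarrow> nat \<Rightarrow> 'a \<Rightarrow> real"
  assumes "\<And>m n. Z m n \<in> borel_measurable N"
    and "\<And>\<omega> t. \<omega> \<in> space N \<Longrightarrow> (\<lambda>m. Z m (grid_index m t) \<omega>) \<longlonglongrightarrow> V t \<omega>"
  shows "(\<lambda>p. V (snd p) (fst p)) \<in> borel_measurable (N \<Otimes>\<^sub>M borel)"
  by (rule borel_measurable_LIMSEQ_real[OF _ time_indexed_measurable[OF assms(1)]])
    (auto simp: space_pair_measure intro: assms(2))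

lemma measurable_pair_expo: "measurable (M \<Otimes>\<^sub>M expo r) N = measurable (M \<Otimes>\<^sub>M borel) N"
  by (intro measurable_cong_sets sets_pair_measure_cong refl sets_expo)

text \<open>
  The quantities introduced below are measured relative to \<open>X 0\<close>, not to \<open>x\<close>, because the two agree
  only almost surely.
\<close>

locale levy = prob_space M for M :: "'a measure" +
  fixes X :: "real \<Rightarrow> 'a \<Rightarrow> real" and x :: real
  assumes levy: "levy_process M X x"

lemma levyI: "levy_process M X x \<Longrightarrow> levy M X x"
  unfolding levy_def levy_axioms_def by (simp add: levy_process_def)

context levy
begin

lemma X_measurable: "0 \<le> t \<Longrightarrow> X t \<in> borel_measurable M"
  and X_start: "AE \<omega> in M. X 0 \<omega> = x"
  and X_cadlag: "\<omega> \<in> space M \<Longrightarrow> cadlag (\<lambda>t. X t \<omega>)"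
  using levy by (auto simp: levy_process_def)

lemma X_grid_measurable [measurable]: "X (grid_time m j) \<in> borel_measurable M"
  by (rule X_measurable[OF grid_time_nonneg])

lemma X_0_measurable [measurable]: "X 0 \<in> borel_measurable M"
  by (rule X_measurable) simp

definition step :: "nat \<Rightarrow> nat \<Rightarrow> 'a \<Rightarrow> real" where
  "step m i \<omega> = X (grid_time m (Suc i)) \<omega> - X (grid_time m i) \<omega>"

lemma psum_step: "psum (\<lambda>i. step m i \<omega>) n = X (grid_time m n) \<omega> - X (grid_time m 0) \<omega>"
  by (induction n) (simp_all add: psum_def step_def)

lemma iid_sequence_step: "iid_sequence M (step m)"
proof (intro iid_sequence.intro iid_sequence_axioms.intro prob_space_axioms)
  have fin: "indep_vars (\<lambda>_. borel) (step m) {..<n}" for n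
  proof -
    have "mono (grid_time m)" by (intro monoI grid_time_mono)
    then show ?thesis
      using levy grid_time_nonneg[of m 0] unfolding levy_process_def step_def[abs_def] by blast
  qed
  show "indep_vars (\<lambda>_. borel) (step m) UNIV"
    unfolding indep_vars_def2
  proof (intro conjI)
    show "\<forall>i\<in>UNIV. random_variable borel (step m i)" by (simp add: step_def[abs_def])
    show "indep_sets (\<lambda>i. {step m i -` A \<inter> space M |A. A \<in> sets borel}) UNIV"
    proof (subst indep_sets_finite_index_sets, intro allI impI)
      fix J :: "nat set" assume "finite J"
      then obtain n where "J \<subseteq> {..<n}" using finite_nat_bounded by blast
      then show "indep_sets (\<lambda>i. {step m i -` A \<inter> space M |A. A \<in> sets borel}) J"
        using fin[of n] unfolding indep_vars_def2 by (blast intro: indep_sets_mono_index)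
    qed
  qed
  have law: "distr M borel (step m i) = distr M borel (\<lambda>\<omega>. X (1 / real (Suc m)) \<omega> - X 0 \<omega>)" for i
  proof -
    have "grid_time m (Suc i) = grid_time m i + 1 / real (Suc m)"
      by (simp add: grid_time_def add_divide_distrib)
    moreover have "(0::real) \<le> 1 / real (Suc m)" by simp
    ultimately show ?thesis
      using levy grid_time_nonneg[of m i] unfolding levy_process_def step_def[abs_def] by metis
  qed
  show "distr M borel (step m i) = distr M borel (step m 0)" for i by (simp only: law)
qed

text \<open>
  The maximum with \<open>0\<close> extends the process constantly to negative times, which the exponential law,
  as a measure on the whole line, does not charge.
\<close>

definition incr :: "real \<Rightarrow> 'a \<Rightarrow> real" where
  "incr t \<omega> = X (max 0 t) \<omega> - X 0 \<omega>"

definition rise :: "real \<Rightarrow> 'a \<Rightarrow> real" where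
  "rise t \<omega> = running_sup X (max 0 t) \<omega> - X 0 \<omega>"

definition fall :: "real \<Rightarrow> 'a \<Rightarrow> real" where
  "fall t \<omega> = running_inf X (max 0 t) \<omega> - X 0 \<omega>"

lemma X_grid_0_tendsto:
  assumes "\<omega> \<in> space M"
  shows "(\<lambda>m. X (grid_time m 0) \<omega>) \<longlonglongrightarrow> X 0 \<omega>"
  by (rule cadlag_right_limit[OF X_cadlag[OF assms] order_refl grid_time_0_tendsto grid_time_nonneg])

lemma walk_tendsto_incr:
  assumes "\<omega> \<in> space M"
  shows "(\<lambda>m. psum (\<lambda>i. step m i \<omega>) (grid_index m t)) \<longlonglongrightarrow> incr t \<omega>"
  unfolding psum_step incr_def
  by (intro tendsto_diff cadlag_grid_tendsto X_cadlag X_grid_0_tendsto assms)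

lemma psum_step_image:
  "psum (\<lambda>i. step m i \<omega>) ` A = (\<lambda>j. X (grid_time m j) \<omega> + (- X (grid_time m 0) \<omega>)) ` A"
  by (simp add: psum_step)

lemma walk_Max_tendsto_rise:
  assumes "\<omega> \<in> space M"
  shows "(\<lambda>m. Max (psum (\<lambda>i. step m i \<omega>) ` {..grid_index m t})) \<longlonglongrightarrow> rise t \<omega>"
proof -
  have "Max (psum (\<lambda>i. step m i \<omega>) ` {..n})
      = Max ((\<lambda>j. X (grid_time m j) \<omega>) ` {..n}) + (- X (grid_time m 0) \<omega>)" for m n
    unfolding psum_step_image by (rule Max_add_commute) auto
  then show ?thesis
    unfolding rise_def running_sup_def
    using tendsto_diff[OF cadlag_grid_Max_tendsto[OF X_cadlag[OF assms]] X_grid_0_tendsto[OF assms]]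
    by simp
qed

lemma walk_Min_tendsto_fall:
  assumes "\<omega> \<in> space M"
  shows "(\<lambda>m. Min (psum (\<lambda>i. step m i \<omega>) ` {..grid_index m t})) \<longlonglongrightarrow> fall t \<omega>"
proof -
  have "Min (psum (\<lambda>i. step m i \<omega>) ` {..n})
      = Min ((\<lambda>j. X (grid_time m j) \<omega>) ` {..n}) + (- X (grid_time m 0) \<omega>)" for m n
    unfolding psum_step_image by (rule Min_add_commute) auto
  then show ?thesis
    unfolding fall_def running_inf_def
    using tendsto_diff[OF cadlag_grid_Min_tendsto[OF X_cadlag[OF assms]] X_grid_0_tendsto[OF assms]]
    by simp
qed

lemma step_measurable [measurable]: "step m i \<in> borel_measurable M"
  unfolding step_def[abs_def] by measurable

lemma walk_measurable: "(\<lambda>\<omega>. psum (\<lambda>i. step m i \<omega>) n) \<in> borel_measurable M"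
  by (rule psum_measurable[of n "\<lambda>\<omega> i. step m i \<omega>"]) simp

lemma walk_Max_measurable: "(\<lambda>\<omega>. Max (psum (\<lambda>i. step m i \<omega>) ` {..n})) \<in> borel_measurable M"
  by (intro borel_measurable_Max walk_measurable) auto

lemma walk_Min_measurable: "(\<lambda>\<omega>. Min (psum (\<lambda>i. step m i \<omega>) ` {..n})) \<in> borel_measurable M"
  by (intro borel_measurable_Min walk_measurable) auto

lemma incr_measurable: "(\<lambda>p. incr (snd p) (fst p)) \<in> borel_measurable (M \<Otimes>\<^sub>M borel)"
  by (rule time_indexed_limit_measurable[where Z = "\<lambda>m n \<omega>. psum (\<lambda>i. step m i \<omega>) n" and V = incr, OF walk_measurable walk_tendsto_incr])

lemma rise_measurable: "(\<lambda>p. rise (snd p) (fst p)) \<in> borel_measurable (M \<Otimes>\<^sub>M borel)"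
  by (rule time_indexed_limit_measurable[where Z = "\<lambda>m n \<omega>. Max (psum (\<lambda>i. step m i \<omega>) ` {..n})" and V = rise, OF walk_Max_measurable walk_Max_tendsto_rise])

text \<open>
  Joint measurability needs only the \<open>\<sigma>\<close>-algebra that makes the coordinates measurable. For the
  \<open>\<sigma>\<close>-algebra generated by the path this is what independence from a random time can be applied to.
\<close>

lemma fall_measurable_subalgebra:
  assumes F: "space F = space M" "\<And>t. 0 \<le> t \<Longrightarrow> X t \<in> borel_measurable F"
  shows "(\<lambda>p. fall (snd p) (fst p)) \<in> borel_measurable (F \<Otimes>\<^sub>M borel)"
proof (rule time_indexed_limit_measurable[where Z = "\<lambda>m n \<omega>. Min (psum (\<lambda>i. step m i \<omega>) ` {..n})"])
  show "(\<lambda>\<omega>. Min (psum (\<lambda>i. step m i \<omega>) ` {..n})) \<in> borel_measurable F" for m n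
    by (intro borel_measurable_Min psum_measurable)
      (auto simp: step_def grid_time_nonneg intro!: borel_measurable_diff F)
qed (simp add: F walk_Min_tendsto_fall)

lemma fall_measurable: "(\<lambda>p. fall (snd p) (fst p)) \<in> borel_measurable (M \<Otimes>\<^sub>M borel)"
  by (rule fall_measurable_subalgebra) (auto intro: X_measurable)

text \<open>The law of \<open>V\<close> at an independent exponential time, realized on the product space.\<close>

definition law_at_expo :: "real \<Rightarrow> (real \<Rightarrow> 'a \<Rightarrow> real) \<Rightarrow> real measure" where
  "law_at_expo r V = distr (M \<Otimes>\<^sub>M expo r) borel (\<lambda>p. V (snd p) (fst p))"

lemma pair_expo: "0 < r \<Longrightarrow> pair_prob_space M (expo r)"
  by (intro pair_prob_space.intro pair_sigma_finite.intro prob_space_imp_sigma_finite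
      prob_space_axioms prob_space_expo)

text \<open>
  By dominated convergence the transform at the exponential time is the limit of the transforms of the
  walks at their geometric times. In particular it is determined by the laws of the discrete functionals.
\<close>

lemma char_law_at_expo:
  fixes Z :: "nat \<Rightarrow> nat \<Rightarrow> 'a \<Rightarrow> real"
  assumes r: "0 < r"
    and Z: "\<And>m n. Z m n \<in> borel_measurable M"
    and lim: "\<And>\<omega> t. \<omega> \<in> space M \<Longrightarrow> (\<lambda>m. Z m (grid_index m t) \<omega>) \<longlonglongrightarrow> V t \<omega>"
  shows "(\<lambda>m. (1 - of_real (exp (- r / real (Suc m))))
             * (\<Sum>n. of_real (exp (- r / real (Suc m))) ^ n * expectation (\<lambda>\<omega>. iexp (u * Z m n \<omega>))))
         \<longlonglongrightarrow> char (law_at_expo r V) u"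
proof -
  interpret E: prob_space "expo r" by (rule prob_space_expo[OF r])
  interpret Q: pair_prob_space M "expo r" by (rule pair_expo[OF r])
  have mV: "(\<lambda>p. V (snd p) (fst p)) \<in> borel_measurable (M \<Otimes>\<^sub>M expo r)"
    unfolding measurable_pair_expo by (rule time_indexed_limit_measurable[where Z = Z and V = V, OF Z lim])
  have mZ: "(\<lambda>p. iexp (u * Z m (grid_index m (snd p)) (fst p))) \<in> borel_measurable (M \<Otimes>\<^sub>M expo r)" for m
    unfolding measurable_pair_expo
    by (rule time_indexed_measurable[of "\<lambda>n \<omega>. iexp (u * Z m n \<omega>)", OF borel_measurable_iexp[OF Z]])
  have "(\<lambda>m. \<integral>p. iexp (u * Z m (grid_index m (snd p)) (fst p)) \<partial>(M \<Otimes>\<^sub>M expo r))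
      \<longlonglongrightarrow> (\<integral>p. iexp (u * V (snd p) (fst p)) \<partial>(M \<Otimes>\<^sub>M expo r))"
  proof (rule integral_dominated_convergence[where w = "\<lambda>_. 1"])
    show "AE p in M \<Otimes>\<^sub>M expo r. (\<lambda>m. iexp (u * Z m (grid_index m (snd p)) (fst p))) \<longlonglongrightarrow> iexp (u * V (snd p) (fst p))"
      by (intro AE_I2 tendsto_intros lim) (auto simp: space_pair_measure)
  qed (rule mZ borel_measurable_iexp[OF mV] | simp)+
  moreover have "(\<integral>p. iexp (u * Z m (grid_index m (snd p)) (fst p)) \<partial>(M \<Otimes>\<^sub>M expo r))
     = (1 - of_real (exp (- r / real (Suc m))))
             * (\<Sum>n. of_real (exp (- r / real (Suc m))) ^ n * expectation (\<lambda>\<omega>. iexp (u * Z m n \<omega>)))" for m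
  proof -
    have "integrable (M \<Otimes>\<^sub>M expo r) (\<lambda>p. iexp (u * Z m (grid_index m (snd p)) (fst p)))"
      by (intro Q.P.integrable_const_bound[where B = 1] mZ) auto
    from Q.integral_snd[of "\<lambda>\<omega> t. iexp (u * Z m (grid_index m t) \<omega>)"] this
    have "(\<integral>p. iexp (u * Z m (grid_index m (snd p)) (fst p)) \<partial>(M \<Otimes>\<^sub>M expo r))
        = (\<integral>t. expectation (\<lambda>\<omega>. iexp (u * Z m (grid_index m t) \<omega>)) \<partial>expo r)"
      by (simp add: split_def)
    also have "\<dots> = (1 - of_real (exp (- r / real (Suc m))))
             * (\<Sum>n. of_real (exp (- r / real (Suc m))) ^ n * expectation (\<lambda>\<omega>. iexp (u * Z m n \<omega>)))"
    proof (rule integral_expo_grid_index[OF r])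
      fix n
      have "norm (expectation (\<lambda>\<omega>. iexp (u * Z m n \<omega>))) \<le> expectation (\<lambda>\<omega>. norm (iexp (u * Z m n \<omega>)))"
        by (rule integral_norm_bound)
      then show "norm (expectation (\<lambda>\<omega>. iexp (u * Z m n \<omega>))) \<le> 1" by (simp add: prob_space)
    qed
    finally show ?thesis .
  qed
  ultimately show ?thesis
    unfolding char_def law_at_expo_def by (simp add: integral_distr[OF mV])
qed

text \<open>
  Pass to the limit in the discrete factorization, for each argument of the transforms, and use that
  transforms determine laws. The product measure means that the supremum and the infimum enter as if
  they were independent.
\<close>

theorem Wiener_Hopf_factorization:
  assumes r: "0 < r"
  shows "law_at_expo r incr
    = distr (law_at_expo r rise \<Otimes>\<^sub>M law_at_expo r fall) borel (\<lambda>p. fst p + snd p)"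
proof -
  interpret Q: pair_prob_space M "expo r" by (rule pair_expo[OF r])
  interpret S: real_distribution "law_at_expo r rise"
    unfolding law_at_expo_def
    by (intro Q.P.real_distribution_distr) (simp only: measurable_pair_expo rise_measurable)
  interpret I: real_distribution "law_at_expo r fall"
    unfolding law_at_expo_def
    by (intro Q.P.real_distribution_distr) (simp only: measurable_pair_expo fall_measurable)
  interpret SI: pair_prob_space "law_at_expo r rise" "law_at_expo r fall" ..
  show ?thesis
  proof (rule Levy_uniqueness)
    show "real_distribution (law_at_expo r incr)"
      unfolding law_at_expo_def
      by (intro Q.P.real_distribution_distr) (simp only: measurable_pair_expo incr_measurable)
    show "real_distribution (distr (law_at_expo r rise \<Otimes>\<^sub>M law_at_expo r fall) borel (\<lambda>p. fst p + snd p))"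
      by (intro SI.P.real_distribution_distr) measurable
    show "char (law_at_expo r incr) = char (distr (law_at_expo r rise \<Otimes>\<^sub>M law_at_expo r fall) borel (\<lambda>p. fst p + snd p))"
    proof
      fix u
      define geo where "geo m c = (1 - of_real (exp (- r / real (Suc m)))) * (\<Sum>n. of_real (exp (- r / real (Suc m))) ^ n * c n)"
        for m and c :: "nat \<Rightarrow> complex"
      have fac: "geo m (\<lambda>n. expectation (\<lambda>\<omega>. iexp (u * psum (\<lambda>i. step m i \<omega>) n)))
        = geo m (\<lambda>n. expectation (\<lambda>\<omega>. iexp (u * Max (psum (\<lambda>i. step m i \<omega>) ` {..n}))))
        * geo m (\<lambda>n. expectation (\<lambda>\<omega>. iexp (u * Min (psum (\<lambda>i. step m i \<omega>) ` {..n}))))" for m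
        unfolding geo_def
        by (rule iid_sequence.Wiener_Hopf_geometric[OF iid_sequence_step]) (use r in auto)
      have "(\<lambda>m. geo m (\<lambda>n. expectation (\<lambda>\<omega>. iexp (u * psum (\<lambda>i. step m i \<omega>) n))))
          \<longlonglongrightarrow> char (law_at_expo r rise) u * char (law_at_expo r fall) u"
        unfolding fac unfolding geo_def
        by (intro tendsto_mult char_law_at_expo[where Z = "\<lambda>m n \<omega>. Max (psum (\<lambda>i. step m i \<omega>) ` {..n})" and V = rise, OF r walk_Max_measurable walk_Max_tendsto_rise]
            char_law_at_expo[where Z = "\<lambda>m n \<omega>. Min (psum (\<lambda>i. step m i \<omega>) ` {..n})" and V = fall, OF r walk_Min_measurable walk_Min_tendsto_fall])
      moreover have "(\<lambda>m. geo m (\<lambda>n. expectation (\<lambda>\<omega>. iexp (u * psum (\<lambda>i. step m i \<omega>) n))))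
          \<longlonglongrightarrow> char (law_at_expo r incr) u"
        unfolding geo_def
        by (rule char_law_at_expo[where Z = "\<lambda>m n \<omega>. psum (\<lambda>i. step m i \<omega>) n" and V = incr, OF r walk_measurable walk_tendsto_incr])
      ultimately have "char (law_at_expo r incr) u = char (law_at_expo r rise) u * char (law_at_expo r fall) u"
        by (rule LIMSEQ_unique[symmetric])
      also have "\<dots> = char (distr (law_at_expo r rise \<Otimes>\<^sub>M law_at_expo r fall) borel (\<lambda>p. fst p + snd p)) u"
      proof -
        have "integrable (law_at_expo r rise \<Otimes>\<^sub>M law_at_expo r fall) (\<lambda>p. iexp (u * (fst p + snd p)))"
          by (intro SI.P.integrable_const_bound[where B = 1]) auto
        from SI.integral_fst'[OF this]
        have "(\<integral>p. iexp (u * (fst p + snd p)) \<partial>(law_at_expo r rise \<Otimes>\<^sub>M law_at_expo r fall))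
            = (\<integral>a. (\<integral>b. iexp (u * a) * iexp (u * b) \<partial>law_at_expo r fall) \<partial>law_at_expo r rise)"
          by (simp add: distrib_left flip: exp_add)
        also have "\<dots> = char (law_at_expo r rise) u * char (law_at_expo r fall) u"
          by (simp add: char_def)
        finally show ?thesis
          unfolding char_def by (subst integral_distr) auto
      qed
      finally show "char (law_at_expo r incr) u = \<dots>" .
    qed
  qed
qed

end

section \<open>From iterated to joint integrability\<close>

lemma continuous_on_UNIV_tendsto:
  fixes g :: "real \<Rightarrow> real"
  assumes "continuous_on UNIV g" "(f \<longlongrightarrow> l) F"
  shows "((\<lambda>x. g (f x)) \<longlongrightarrow> g l) F"
  by (rule continuous_on_tendsto_compose[OF assms]) auto

text \<open>
  The correlation inequality is about finitely many steps, whereas the index of a time is unbounded.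
  The cut at \<open>(m + 1)\<^sup>2\<close> is eventually inactive for each fixed time.
\<close>

definition cut_index :: "nat \<Rightarrow> real \<Rightarrow> nat" where
  "cut_index m s = min (Suc m * Suc m) (grid_index m s)"

lemma cut_index_measurable [measurable]: "cut_index m \<in> borel \<rightarrow>\<^sub>M count_space UNIV"
  unfolding cut_index_def[abs_def] by measurable

lemma eventually_cut_index: "eventually (\<lambda>m. cut_index m s = grid_index m s) sequentially"
proof -
  have "eventually (\<lambda>m. s \<le> real m) sequentially"
    using eventually_ge_at_top[of "nat \<lceil>s\<rceil>"] by eventually_elim linarith
  then show ?thesis
  proof eventually_elim
    case (elim m)
    have "real (Suc m) \<le> grid_time m (Suc m * Suc m)"
      unfolding grid_time_def by (simp add: field_simps)
    then have "grid_index m s \<le> Suc m * Suc m"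
      using elim by (simp add: grid_index_le_iff)
    then show ?case by (simp add: cut_index_def)
  qed
qed

lemma psum_mono: "(\<And>i. i < j \<Longrightarrow> x i \<le> y i) \<Longrightarrow> psum x j \<le> psum y j"
  unfolding psum_def by (intro sum_mono) auto

context levy
begin

lemma incr_section_measurable:
  assumes "\<omega> \<in> space M"
  shows "(\<lambda>t. incr t \<omega>) \<in> borel_measurable borel"
  using measurable_compose[OF measurable_Pair1'[OF assms] incr_measurable] by simp

lemma incr_time_measurable: "incr t \<in> borel_measurable M"
  unfolding incr_def[abs_def] by (intro borel_measurable_diff X_measurable) auto

text \<open>
  Both factors are increasing functionals of the increments of the process: \<open>a\<close> is increasing, and
  raising the path lowers \<open>b\<close> and hence raises the exponential. Discretize, apply the Harris inequality
  to the steps of the walk, and pass to the limit.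
\<close>

lemma incr_discount_associated:
  fixes a b :: "real \<Rightarrow> real"
  assumes r: "0 < r"
    and a: "mono a" "continuous_on UNIV a" "\<And>z. \<bar>a z\<bar> \<le> A"
    and b: "antimono b" "continuous_on UNIV b" "\<And>z. 0 \<le> b z" "\<And>z. b z \<le> K"
  shows "expectation (\<lambda>\<omega>. a (incr t \<omega>)) * expectation (\<lambda>\<omega>. exp (- (\<integral>s. b (incr s \<omega>) \<partial>expo r)))
    \<le> expectation (\<lambda>\<omega>. a (incr t \<omega>) * exp (- (\<integral>s. b (incr s \<omega>) \<partial>expo r)))"
proof -
  interpret E: prob_space "expo r" by (rule prob_space_expo[OF r])
  note [measurable] = borel_measurable_continuous_onI[OF a(2)] borel_measurable_continuous_onI[OF b(2)]
  define N where "N m = Suc m * Suc m" for m :: nat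
  define f where "f m x = a (psum x (cut_index m t))" for m :: nat and x
  define h where "h m x = exp (- (\<integral>s. b (psum x (cut_index m s)) \<partial>expo r))" for m :: nat and x
  have cut_le: "cut_index m s \<le> N m" for m s by (simp add: cut_index_def N_def)
  have int_b: "integrable (expo r) (\<lambda>s. b (v (cut_index m s)))" for v :: "nat \<Rightarrow> real" and m
  proof (rule E.integrable_const_bound[where B = K])
    show "AE s in expo r. norm (b (v (cut_index m s))) \<le> K" using b by (intro AE_I2) simp
    have "(\<lambda>s. b (v (cut_index m s))) \<in> borel_measurable borel"
      by (rule measurable_compose[OF cut_index_measurable]) simp
    then show "(\<lambda>s. b (v (cut_index m s))) \<in> borel_measurable (expo r)"
      by (simp cong: measurable_cong_sets)
  qed
  have f_meas: "(\<lambda>\<omega>. f m (v \<omega>)) \<in> borel_measurable P"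
    if "\<And>i. i < N m \<Longrightarrow> (\<lambda>\<omega>. v \<omega> i) \<in> borel_measurable P" for m and v :: "'c \<Rightarrow> nat \<Rightarrow> real" and P
    unfolding f_def using cut_le[of m t] that
    by (intro measurable_compose[OF psum_measurable borel_measurable_continuous_onI[OF a(2)]]) auto
  have h_meas: "(\<lambda>\<omega>. h m (v \<omega>)) \<in> borel_measurable P"
    if v: "\<And>i. i < N m \<Longrightarrow> (\<lambda>\<omega>. v \<omega> i) \<in> borel_measurable P" for m and v :: "'c \<Rightarrow> nat \<Rightarrow> real" and P
  proof -
    let ?Z = "\<lambda>j \<omega>. b (psum (v \<omega>) (min (N m) j))"
    have "?Z j \<in> borel_measurable P" for j
      by (intro measurable_compose[OF psum_measurable borel_measurable_continuous_onI[OF b(2)]] v) auto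
    from time_indexed_measurable[of ?Z, OF this]
    have "(\<lambda>p. b (psum (v (fst p)) (cut_index m (snd p)))) \<in> borel_measurable (P \<Otimes>\<^sub>M expo r)"
      by (simp add: measurable_pair_expo cut_index_def N_def)
    then have "(\<lambda>\<omega>. \<integral>s. b (psum (v \<omega>) (cut_index m s)) \<partial>expo r) \<in> borel_measurable P"
      by (intro E.borel_measurable_lebesgue_integral) (simp add: split_def)
    then show ?thesis unfolding h_def by measurable
  qed
  have h01: "0 < h m x" "h m x \<le> 1" for m x
    using b unfolding h_def by (auto intro!: integral_nonneg_AE)
  have disc: "expectation (\<lambda>\<omega>. f m (\<lambda>i. step m i \<omega>)) * expectation (\<lambda>\<omega>. h m (\<lambda>i. step m i \<omega>))
      \<le> expectation (\<lambda>\<omega>. f m (\<lambda>i. step m i \<omega>) * h m (\<lambda>i. step m i \<omega>))" for m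
  proof (rule iid_sequence.increments_associated[OF iid_sequence_step, where n = "N m" and B = A and C = 1])
    show "f m \<in> borel_measurable (\<Pi>\<^sub>M i\<in>{..<N m}. borel)" by (rule f_meas) auto
    show "h m \<in> borel_measurable (\<Pi>\<^sub>M i\<in>{..<N m}. borel)" by (rule h_meas) auto
    show "\<bar>f m x\<bar> \<le> A" for x using a by (simp add: f_def)
    show "\<bar>h m x\<bar> \<le> 1" for x using h01[of m x] by simp
    fix x y :: "nat \<Rightarrow> real" assume xy: "\<And>i. i < N m \<Longrightarrow> x i \<le> y i"
    have p: "psum x (cut_index m s) \<le> psum y (cut_index m s)" for s
      using cut_le[of m s] by (intro psum_mono xy) simp
    show "f m x \<le> f m y" unfolding f_def by (rule monoD[OF a(1) p])
    show "h m x \<le> h m y" unfolding h_def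
      by (simp, intro integral_mono int_b antimonoD[OF b(1) p])
  qed
  have walk: "(\<lambda>m. psum (\<lambda>i. step m i \<omega>) (cut_index m s)) \<longlonglongrightarrow> incr s \<omega>" if "\<omega> \<in> space M" for s \<omega>
  proof (rule Lim_transform_eventually[OF walk_tendsto_incr[OF that]])
    show "eventually (\<lambda>m. psum (\<lambda>i. step m i \<omega>) (grid_index m s) = psum (\<lambda>i. step m i \<omega>) (cut_index m s)) sequentially"
      using eventually_cut_index[of s] by eventually_elim simp
  qed
  have f_lim: "(\<lambda>m. f m (\<lambda>i. step m i \<omega>)) \<longlonglongrightarrow> a (incr t \<omega>)" if "\<omega> \<in> space M" for \<omega>
    unfolding f_def by (rule continuous_on_UNIV_tendsto[OF a(2) walk[OF that]])
  have h_lim: "(\<lambda>m. h m (\<lambda>i. step m i \<omega>)) \<longlonglongrightarrow> exp (- (\<integral>s. b (incr s \<omega>) \<partial>expo r))" if "\<omega> \<in> space M" for \<omega>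
    unfolding h_def
  proof (intro tendsto_exp tendsto_minus integral_dominated_convergence[where w = "\<lambda>_. K"])
    show "(\<lambda>s. b (incr s \<omega>)) \<in> borel_measurable (expo r)"
      using measurable_compose[OF incr_section_measurable[OF that] borel_measurable_continuous_onI[OF b(2)]]
      by (simp cong: measurable_cong_sets)
    show "(\<lambda>s. b (psum (\<lambda>i. step m i \<omega>) (cut_index m s))) \<in> borel_measurable (expo r)" for m
      using int_b by (rule borel_measurable_integrable)
    show "AE s in expo r. (\<lambda>m. b (psum (\<lambda>i. step m i \<omega>) (cut_index m s))) \<longlonglongrightarrow> b (incr s \<omega>)"
      by (intro AE_I2 continuous_on_UNIV_tendsto[OF b(2)] walk that)
  qed (use b in auto)
  have fm: "(\<lambda>\<omega>. f m (\<lambda>i. step m i \<omega>)) \<in> borel_measurable M" for m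
    by (rule f_meas) simp
  have hm: "(\<lambda>\<omega>. h m (\<lambda>i. step m i \<omega>)) \<in> borel_measurable M" for m
    by (rule h_meas) simp
  have fm': "(\<lambda>\<omega>. a (incr t \<omega>)) \<in> borel_measurable M"
    by (rule borel_measurable_LIMSEQ_real[OF f_lim fm])
  have hm': "(\<lambda>\<omega>. exp (- (\<integral>s. b (incr s \<omega>) \<partial>expo r))) \<in> borel_measurable M"
    by (rule borel_measurable_LIMSEQ_real[OF h_lim hm])
  have fb: "\<bar>f m x\<bar> \<le> A" for m x using a by (simp add: f_def)
  have A0: "0 \<le> A" using a(3)[of 0] by simp
  have fhb: "\<bar>f m x * h m x\<bar> \<le> A" for m x
    using mult_mono[OF fb[of m x], of "h m x" 1] h01[of m x] A0 by (simp add: abs_mult)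
  have l1: "(\<lambda>m. expectation (\<lambda>\<omega>. f m (\<lambda>i. step m i \<omega>))) \<longlonglongrightarrow> expectation (\<lambda>\<omega>. a (incr t \<omega>))"
    by (rule integral_dominated_convergence[where w = "\<lambda>_. A"])
      (use fm fm' f_lim fb in auto)
  have l2: "(\<lambda>m. expectation (\<lambda>\<omega>. h m (\<lambda>i. step m i \<omega>)))
      \<longlonglongrightarrow> expectation (\<lambda>\<omega>. exp (- (\<integral>s. b (incr s \<omega>) \<partial>expo r)))"
    by (rule integral_dominated_convergence[where w = "\<lambda>_. 1"])
      (use hm hm' h_lim h01 in \<open>auto simp: less_imp_le abs_of_pos\<close>)
  have l3: "(\<lambda>m. expectation (\<lambda>\<omega>. f m (\<lambda>i. step m i \<omega>) * h m (\<lambda>i. step m i \<omega>)))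
      \<longlonglongrightarrow> expectation (\<lambda>\<omega>. a (incr t \<omega>) * exp (- (\<integral>s. b (incr s \<omega>) \<partial>expo r)))"
  proof (rule integral_dominated_convergence[where w = "\<lambda>_. A"])
    show "AE \<omega> in M. (\<lambda>m. f m (\<lambda>i. step m i \<omega>) * h m (\<lambda>i. step m i \<omega>))
        \<longlonglongrightarrow> a (incr t \<omega>) * exp (- (\<integral>s. b (incr s \<omega>) \<partial>expo r))"
      by (intro AE_I2 tendsto_mult f_lim h_lim)
  qed (use fm fm' hm hm' fhb in \<open>auto intro!: borel_measurable_times\<close>)
  show ?thesis
    by (rule LIMSEQ_le[OF tendsto_mult[OF l1 l2] l3]) (use disc in blast)
qed

text \<open>
  Let \<open>A\<close> and \<open>B\<close> be the discounted integrals of the positive and of the negative part of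
  \<open>g (incr t)\<close>. The hypotheses only control \<open>A - B\<close>, so a priori \<open>A\<close> and \<open>B\<close> could both have
  infinite expectation. However, \<open>A\<close> and \<open>exp (- B)\<close> are both increasing functionals of the path,
  hence positively correlated, and \<open>A * exp (- B) \<le> \<bar>A - B\<bar> + B * exp (- B) \<le> \<bar>A - B\<bar> + 1\<close>. Thus
  \<open>E A * E (exp (- B)) \<le> E \<bar>A - B\<bar> + 1\<close>, where \<open>E (exp (- B)) > 0\<close> because \<open>B\<close> is almost surely
  finite. So \<open>A\<close> is integrable, and then so is \<open>B\<close>.
\<close>

lemma integrable_of_iterated:
  fixes g :: "real \<Rightarrow> real"
  assumes r: "0 < r" and g: "mono g" "continuous_on UNIV g"
    and path: "AE \<omega> in M. integrable (expo r) (\<lambda>t. g (incr t \<omega>))"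
    and mean: "integrable M (\<lambda>\<omega>. \<integral>t. g (incr t \<omega>) \<partial>expo r)"
  shows "integrable (M \<Otimes>\<^sub>M expo r) (\<lambda>p. g (incr (snd p) (fst p)))"
proof -
  interpret E: prob_space "expo r" by (rule prob_space_expo[OF r])
  interpret Q: pair_prob_space M "expo r" by (rule pair_expo[OF r])
  let ?p = "\<lambda>z. max 0 (g z)" and ?m = "\<lambda>z. max 0 (- g z)"
  let ?a = "\<lambda>n z. min (real n) (max 0 (g z))" and ?b = "\<lambda>n z. min (real n) (max 0 (- g z))"
  note gm [measurable] = borel_measurable_continuous_onI[OF g(2)]
  have Qm [measurable]: "(\<lambda>p. incr (snd p) (fst p)) \<in> borel_measurable (M \<Otimes>\<^sub>M expo r)"
    unfolding measurable_pair_expo by (rule incr_measurable)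
  have sec: "(\<lambda>t. incr t \<omega>) \<in> borel_measurable (expo r)" if "\<omega> \<in> space M" for \<omega>
    using incr_section_measurable[OF that] by (simp cong: measurable_cong_sets)
  have pmeas: "(\<lambda>\<omega>. \<integral>t. \<phi> (incr t \<omega>) \<partial>expo r) \<in> borel_measurable M"
    if [measurable]: "\<phi> \<in> borel_measurable borel" for \<phi> :: "real \<Rightarrow> real"
  proof -
    have "(\<lambda>p. \<phi> (incr (snd p) (fst p))) \<in> borel_measurable (M \<Otimes>\<^sub>M expo r)"
      by measurable
    then show ?thesis by (intro E.borel_measurable_lebesgue_integral) (simp add: split_def)
  qed
  define A B where "A \<omega> = (\<integral>t. ?p (incr t \<omega>) \<partial>expo r)" and "B \<omega> = (\<integral>t. ?m (incr t \<omega>) \<partial>expo r)" for \<omega>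
  have [measurable]: "A \<in> borel_measurable M" "B \<in> borel_measurable M"
    unfolding A_def[abs_def] B_def[abs_def] by (intro pmeas; measurable)+
  have A0: "0 \<le> A \<omega>" and B0: "0 \<le> B \<omega>" for \<omega>
    unfolding A_def B_def by (auto intro!: integral_nonneg_AE)
  define d where "d \<omega> = (\<integral>t. g (incr t \<omega>) \<partial>expo r)" for \<omega>
  have d: "AE \<omega> in M. integrable (expo r) (\<lambda>t. ?p (incr t \<omega>)) \<and> integrable (expo r) (\<lambda>t. ?m (incr t \<omega>))
      \<and> d \<omega> = A \<omega> - B \<omega>"
    using path
  proof eventually_elim
    case (elim \<omega>)
    then have i: "integrable (expo r) (\<lambda>t. ?p (incr t \<omega>))" "integrable (expo r) (\<lambda>t. ?m (incr t \<omega>))"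
      by auto
    have "d \<omega> = (\<integral>t. ?p (incr t \<omega>) - ?m (incr t \<omega>) \<partial>expo r)"
      unfolding d_def by (intro Bochner_Integration.integral_cong refl) auto
    also have "\<dots> = A \<omega> - B \<omega>"
      unfolding A_def B_def by (rule Bochner_Integration.integral_diff[OF i])
    finally show ?case using i by simp
  qed
  define c where "c = expectation (\<lambda>\<omega>. exp (- B \<omega>))"
  have int_exp: "integrable M (\<lambda>\<omega>. exp (- B \<omega>))"
    using B0 by (intro integrable_const_bound[where B = 1]) auto
  have c: "0 < c"
  proof -
    have "c \<noteq> 0"
      unfolding c_def using int_exp prob_space
      by (subst integral_nonneg_eq_0_iff_AE) (auto simp: AE_False)
    moreover have "0 \<le> c" unfolding c_def by (intro integral_nonneg_AE) auto
    ultimately show ?thesis by simp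
  qed
  have at_time: "expectation (\<lambda>\<omega>. ?a n (incr t \<omega>)) * c \<le> expectation (\<lambda>\<omega>. ?a n (incr t \<omega>) * exp (- B \<omega>))" for n t
  proof -
    let ?e = "\<lambda>k \<omega>. exp (- (\<integral>s. ?b k (incr s \<omega>) \<partial>expo r))"
    note [measurable] = incr_time_measurable[of t]
    have em: "?e k \<in> borel_measurable M" for k
    proof -
      have [measurable]: "(\<lambda>\<omega>. \<integral>s. ?b k (incr s \<omega>) \<partial>expo r) \<in> borel_measurable M"
        by (intro pmeas) measurable
      show ?thesis by measurable
    qed
    have e1: "?e k \<omega> \<le> 1" for k \<omega> by (auto intro!: integral_nonneg_AE)
    have lim: "AE \<omega> in M. (\<lambda>k. ?e k \<omega>) \<longlonglongrightarrow> exp (- B \<omega>)"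
      using d AE_space
    proof eventually_elim
      case (elim \<omega>)
      note [measurable] = sec[OF elim(2)]
      have "(\<lambda>k. \<integral>s. ?b k (incr s \<omega>) \<partial>expo r) \<longlonglongrightarrow> B \<omega>"
        unfolding B_def
      proof (rule integral_dominated_convergence[where w = "\<lambda>s. ?m (incr s \<omega>)"])
        show "AE s in expo r. (\<lambda>k. ?b k (incr s \<omega>)) \<longlonglongrightarrow> ?m (incr s \<omega>)"
        proof (intro AE_I2 tendsto_eventually)
          fix s
          show "eventually (\<lambda>k. ?b k (incr s \<omega>) = ?m (incr s \<omega>)) sequentially"
            using eventually_ge_at_top[of "nat \<lceil>?m (incr s \<omega>)\<rceil>"]
            by eventually_elim (simp add: min_def, linarith)
        qed
      qed (use elim in auto)
      then show ?case by (intro tendsto_intros)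
    qed
    have "(\<lambda>k. expectation (\<lambda>\<omega>. ?a n (incr t \<omega>)) * expectation (?e k)) \<longlonglongrightarrow> expectation (\<lambda>\<omega>. ?a n (incr t \<omega>)) * c"
      unfolding c_def
      by (intro tendsto_mult tendsto_const integral_dominated_convergence[where w = "\<lambda>_. 1"])
        (use lim em e1 in auto)
    moreover have "(\<lambda>k. expectation (\<lambda>\<omega>. ?a n (incr t \<omega>) * ?e k \<omega>))
        \<longlonglongrightarrow> expectation (\<lambda>\<omega>. ?a n (incr t \<omega>) * exp (- B \<omega>))"
    proof (rule integral_dominated_convergence[where w = "\<lambda>_. real n"])
      show "AE \<omega> in M. (\<lambda>k. ?a n (incr t \<omega>) * ?e k \<omega>) \<longlonglongrightarrow> ?a n (incr t \<omega>) * exp (- B \<omega>)"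
        using lim by eventually_elim (intro tendsto_mult tendsto_const)
      show "AE \<omega> in M. norm (?a n (incr t \<omega>) * ?e k \<omega>) \<le> real n" for k
      proof (intro AE_I2)
        fix \<omega>
        have "?a n (incr t \<omega>) * ?e k \<omega> \<le> real n * 1"
          by (intro mult_mono e1) auto
        then show "norm (?a n (incr t \<omega>) * ?e k \<omega>) \<le> real n" by (simp add: abs_mult)
      qed
      show "(\<lambda>\<omega>. ?a n (incr t \<omega>) * ?e k \<omega>) \<in> borel_measurable M" for k
        by (intro borel_measurable_times em) measurable
    qed (simp, measurable)
    ultimately show ?thesis
    proof (rule LIMSEQ_le, intro exI allI impI)
      fix k
      show "expectation (\<lambda>\<omega>. ?a n (incr t \<omega>)) * expectation (?e k) \<le> expectation (\<lambda>\<omega>. ?a n (incr t \<omega>) * ?e k \<omega>)"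
      proof (rule incr_discount_associated[OF r, where A = "real n" and K = "real k"])
        show "mono (?a n)" using g(1) by (auto simp: mono_def min_def max_def intro: order_trans) 
        show "antimono (?b k)"
        proof (rule antimonoI)
          fix y z :: real assume "y \<le> z"
          then have "g y \<le> g z" by (rule monoD[OF g(1)])
          then show "?b k z \<le> ?b k y" by auto
        qed
        show "continuous_on UNIV (?a n)" "continuous_on UNIV (?b k)" by (intro continuous_intros g(2))+
      qed auto
    qed
  qed
  define K where "K = (expectation (\<lambda>\<omega>. \<bar>d \<omega>\<bar>) + 1) / c"
  have int_a: "integrable (M \<Otimes>\<^sub>M expo r) (\<lambda>p. ?a n (incr (snd p) (fst p)))" for n
    by (intro Q.P.integrable_const_bound[where B = "real n"]) auto
  have bound: "(\<integral>p. ?a n (incr (snd p) (fst p)) \<partial>(M \<Otimes>\<^sub>M expo r)) \<le> K" for n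
  proof -
    have int_ae: "integrable (M \<Otimes>\<^sub>M expo r) (\<lambda>p. ?a n (incr (snd p) (fst p)) * exp (- B (fst p)))"
    proof (rule Bochner_Integration.integrable_bound[OF int_a[of n]])
      show "AE p in M \<Otimes>\<^sub>M expo r. norm (?a n (incr (snd p) (fst p)) * exp (- B (fst p))) \<le> norm (?a n (incr (snd p) (fst p)))"
        using B0 unfolding norm_mult by (intro AE_I2 mult_left_le) auto
    qed measurable
    have "(\<integral>p. ?a n (incr (snd p) (fst p)) \<partial>(M \<Otimes>\<^sub>M expo r)) * c
        = (\<integral>t. expectation (\<lambda>\<omega>. ?a n (incr t \<omega>)) * c \<partial>expo r)"
      using Q.integral_snd[of "\<lambda>\<omega> t. ?a n (incr t \<omega>)"] int_a[of n] by (simp add: split_def)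
    also have "\<dots> \<le> (\<integral>t. expectation (\<lambda>\<omega>. ?a n (incr t \<omega>) * exp (- B \<omega>)) \<partial>expo r)"
    proof (intro integral_mono at_time)
      show "integrable (expo r) (\<lambda>t. expectation (\<lambda>\<omega>. ?a n (incr t \<omega>)) * c)"
        using Q.integrable_snd[of "\<lambda>\<omega> t. ?a n (incr t \<omega>)"] int_a[of n] by (simp add: split_def)
      show "integrable (expo r) (\<lambda>t. expectation (\<lambda>\<omega>. ?a n (incr t \<omega>) * exp (- B \<omega>)))"
        using Q.integrable_snd[of "\<lambda>\<omega> t. ?a n (incr t \<omega>) * exp (- B \<omega>)"] int_ae by (simp add: split_def)
    qed
    also have "\<dots> = (\<integral>p. ?a n (incr (snd p) (fst p)) * exp (- B (fst p)) \<partial>(M \<Otimes>\<^sub>M expo r))"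
      using Q.integral_snd[of "\<lambda>\<omega> t. ?a n (incr t \<omega>) * exp (- B \<omega>)"] int_ae by (simp add: split_def)
    also have "\<dots> = expectation (\<lambda>\<omega>. (\<integral>t. ?a n (incr t \<omega>) * exp (- B \<omega>) \<partial>expo r))"
      using Q.integral_fst'[OF int_ae] by simp
    also have "\<dots> \<le> expectation (\<lambda>\<omega>. \<bar>d \<omega>\<bar> + 1)"
    proof (rule integral_mono_AE)
      show "integrable M (\<lambda>\<omega>. \<integral>t. ?a n (incr t \<omega>) * exp (- B \<omega>) \<partial>expo r)"
        using Q.integrable_fst'[OF int_ae] by simp
      show "integrable M (\<lambda>\<omega>. \<bar>d \<omega>\<bar> + 1)" using mean unfolding d_def[symmetric] by simp
      show "AE \<omega> in M. (\<integral>t. ?a n (incr t \<omega>) * exp (- B \<omega>) \<partial>expo r) \<le> \<bar>d \<omega>\<bar> + 1"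
        using d AE_space
      proof eventually_elim
        case (elim \<omega>)
        note [measurable] = sec[OF elim(2)]
        have "(\<integral>t. ?a n (incr t \<omega>) \<partial>expo r) \<le> A \<omega>"
          unfolding A_def
        proof (rule integral_mono)
          show "integrable (expo r) (\<lambda>t. ?a n (incr t \<omega>))"
            by (intro E.integrable_const_bound[where B = "real n"]) auto
        qed (use elim in auto)
        then have "(\<integral>t. ?a n (incr t \<omega>) * exp (- B \<omega>) \<partial>expo r) \<le> A \<omega> * exp (- B \<omega>)"
          by simp
        also have "\<dots> \<le> \<bar>d \<omega>\<bar> * exp (- B \<omega>) + B \<omega> * exp (- B \<omega>)"
          unfolding distrib_right[symmetric] using elim by (intro mult_right_mono) auto
        also have "\<dots> \<le> \<bar>d \<omega>\<bar> + 1"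
        proof (rule add_mono)
          show "\<bar>d \<omega>\<bar> * exp (- B \<omega>) \<le> \<bar>d \<omega>\<bar>" using B0[of \<omega>] by (intro mult_left_le) auto
          have "B \<omega> \<le> exp (B \<omega>)" using exp_ge_add_one_self[of "B \<omega>"] by linarith
          then show "B \<omega> * exp (- B \<omega>) \<le> 1" by (simp add: exp_minus field_simps)
        qed
        finally show ?case .
      qed
    qed
    also have "\<dots> = expectation (\<lambda>\<omega>. \<bar>d \<omega>\<bar>) + 1"
      using mean unfolding d_def[symmetric] by (simp add: prob_space)
    finally show ?thesis using c by (simp add: K_def field_simps)
  qed
  have int_p: "integrable (M \<Otimes>\<^sub>M expo r) (\<lambda>p. ?p (incr (snd p) (fst p)))"
  proof (rule integrableI_bounded)
    have "(\<lambda>n. \<integral>\<^sup>+p. ennreal (?a n (incr (snd p) (fst p))) \<partial>(M \<Otimes>\<^sub>M expo r))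
        \<longlonglongrightarrow> (\<integral>\<^sup>+p. ennreal (?p (incr (snd p) (fst p))) \<partial>(M \<Otimes>\<^sub>M expo r))"
    proof (rule nn_integral_LIMSEQ)
      show "incseq (\<lambda>n p. ennreal (?a n (incr (snd p) (fst p))))"
        by (auto simp: incseq_def le_fun_def intro!: ennreal_leI)
      show "(\<lambda>n. ennreal (?a n (incr (snd p) (fst p)))) \<longlonglongrightarrow> ennreal (?p (incr (snd p) (fst p)))" for p
      proof (rule tendsto_eventually)
        show "eventually (\<lambda>n. ennreal (?a n (incr (snd p) (fst p))) = ennreal (?p (incr (snd p) (fst p)))) sequentially"
          using eventually_ge_at_top[of "nat \<lceil>?p (incr (snd p) (fst p))\<rceil>"]
          by eventually_elim (rule arg_cong[where f = ennreal], simp add: min_def, linarith)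
      qed
    qed measurable
    moreover have "(\<integral>\<^sup>+p. ennreal (?a n (incr (snd p) (fst p))) \<partial>(M \<Otimes>\<^sub>M expo r)) \<le> ennreal K" for n
      using bound[of n] int_a[of n] by (subst nn_integral_eq_integral) (auto intro!: ennreal_leI)
    ultimately have "(\<integral>\<^sup>+p. ennreal (?p (incr (snd p) (fst p))) \<partial>(M \<Otimes>\<^sub>M expo r)) \<le> ennreal K"
      by (intro LIMSEQ_le_const2) auto
    then show "(\<integral>\<^sup>+p. ennreal (norm (?p (incr (snd p) (fst p)))) \<partial>(M \<Otimes>\<^sub>M expo r)) < \<infinity>"
      by (simp add: order.strict_trans1)
  qed measurable
  \<comment> \<open>Now \<open>B = A - d\<close> almost surely, with both terms integrable.\<close>
  have int_m: "integrable (M \<Otimes>\<^sub>M expo r) (\<lambda>p. ?m (incr (snd p) (fst p)))"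
  proof (rule Q.Fubini_integrable)
    have "integrable M A"
      using Q.integrable_fst'[OF int_p] by (simp add: A_def[abs_def])
    then have "integrable M (\<lambda>\<omega>. A \<omega> - d \<omega>)" using mean unfolding d_def[symmetric] by simp
    then have "integrable M B"
      by (rule integrable_cong_AE_imp) (use d in auto)
    then show "integrable M (\<lambda>\<omega>. \<integral>t. norm (?m (incr (snd (\<omega>, t)) (fst (\<omega>, t)))) \<partial>expo r)"
      by (simp add: B_def[abs_def])
    show "AE \<omega> in M. integrable (expo r) (\<lambda>t. ?m (incr (snd (\<omega>, t)) (fst (\<omega>, t))))"
      using d by eventually_elim simp
  qed measurable
  have "integrable (M \<Otimes>\<^sub>M expo r) (\<lambda>p. ?p (incr (snd p) (fst p)) - ?m (incr (snd p) (fst p)))"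
    by (rule Bochner_Integration.integrable_diff[OF int_p int_m])
  moreover have "(\<lambda>p. ?p (incr (snd p) (fst p)) - ?m (incr (snd p) (fst p))) = (\<lambda>p. g (incr (snd p) (fst p)))"
    by auto
  ultimately show ?thesis by simp
qed

end

section \<open>Transfer between processes with the same path law, and independent times\<close>

lemma path_measurable:
  assumes "\<And>t. 0 \<le> t \<Longrightarrow> X t \<in> borel_measurable M"
  shows "path X \<in> M \<rightarrow>\<^sub>M path_space"
  unfolding path_def[abs_def] path_space_def using assms by (intro measurable_restrict) auto

lemma (in levy) real_distribution_law_at_expo:
  assumes "0 < r" "(\<lambda>p. V (snd p) (fst p)) \<in> borel_measurable (M \<Otimes>\<^sub>M borel)"
  shows "real_distribution (law_at_expo r V)"
proof -
  interpret Q: pair_prob_space M "expo r" by (rule pair_expo[OF assms(1)])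
  show ?thesis
    unfolding law_at_expo_def using assms(2)
    by (intro Q.P.real_distribution_distr) (simp only: measurable_pair_expo)
qed

text \<open>A shift of the path by the constant \<open>d\<close> does not change its steps.\<close>

lemma grid_functional_law_cong:
  assumes M: "levy M X x" and N: "levy N Y y"
    and law: "distr M path_space (path X) = distr N path_space (path (\<lambda>t \<omega>. d + Y t \<omega>))"
    and \<Psi>: "\<And>P v. (\<And>i :: nat. (\<lambda>p. v p i) \<in> borel_measurable P) \<Longrightarrow> (\<lambda>p :: real \<Rightarrow> real. \<Psi> (v p)) \<in> borel_measurable P"
  shows "distr M borel (\<lambda>\<omega>. \<Psi> (\<lambda>i. levy.step X m i \<omega>)) = distr N borel (\<lambda>\<omega>. \<Psi> (\<lambda>i. levy.step Y m i \<omega>) :: real)"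
proof -
  interpret A: levy M X x by (rule M)
  interpret B: levy N Y y by (rule N)
  let ?\<Phi> = "\<lambda>p. \<Psi> (\<lambda>i. p (grid_time m (Suc i)) - p (grid_time m i))"
  have \<Phi>: "?\<Phi> \<in> borel_measurable path_space"
    unfolding path_space_def
    by (intro \<Psi> borel_measurable_diff measurable_component_singleton) (auto simp: grid_time_nonneg)
  have pX: "path X \<in> M \<rightarrow>\<^sub>M path_space" by (rule path_measurable[OF A.X_measurable])
  have pY: "path (\<lambda>t \<omega>. d + Y t \<omega>) \<in> N \<rightarrow>\<^sub>M path_space"
    by (intro path_measurable borel_measurable_add borel_measurable_const B.X_measurable)
  have "distr M borel (\<lambda>\<omega>. \<Psi> (\<lambda>i. A.step m i \<omega>)) = distr (distr M path_space (path X)) borel ?\<Phi>"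
    by (subst distr_distr[OF \<Phi> pX]) (simp add: comp_def path_def A.step_def grid_time_nonneg)
  also have "\<dots> = distr N borel (\<lambda>\<omega>. \<Psi> (\<lambda>i. B.step m i \<omega>))"
    unfolding law by (subst distr_distr[OF \<Phi> pY]) (simp add: comp_def path_def B.step_def grid_time_nonneg)
  finally show ?thesis .
qed

text \<open>
  The transforms of both laws are limits of transforms of functionals of finitely many path values.
  This transports laws between different starting points and from the process to its copy.
\<close>

lemma law_at_expo_cong:
  assumes M: "levy M X x" and N: "levy N Y y" and r: "0 < r"
    and law: "distr M path_space (path X) = distr N path_space (path (\<lambda>t \<omega>. d + Y t \<omega>))"
  shows "levy.law_at_expo M r (levy.incr X) = levy.law_at_expo N r (levy.incr Y)"
    and "levy.law_at_expo M r (levy.fall X) = levy.law_at_expo N r (levy.fall Y)"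
proof -
  interpret A: levy M X x by (rule M)
  interpret B: levy N Y y by (rule N)
  have char: "A.expectation (\<lambda>\<omega>. iexp (u * Z \<omega>)) = B.expectation (\<lambda>\<omega>. iexp (u * Z' \<omega>))"
    if "distr M borel Z = distr N borel Z'" "Z \<in> borel_measurable M" "Z' \<in> borel_measurable N" for Z Z' u
  proof -
    have "A.expectation (\<lambda>\<omega>. iexp (u * Z \<omega>)) = char (distr M borel Z) u"
      unfolding char_def by (rule integral_distr[OF that(2), symmetric]) measurable
    also have "\<dots> = char (distr N borel Z') u" by (simp only: that(1))
    also have "\<dots> = B.expectation (\<lambda>\<omega>. iexp (u * Z' \<omega>))"
      unfolding char_def by (rule integral_distr[OF that(3)]) measurable
    finally show ?thesis .
  qed
  have walk: "distr M borel (\<lambda>\<omega>. psum (\<lambda>i. A.step m i \<omega>) n) = distr N borel (\<lambda>\<omega>. psum (\<lambda>i. B.step m i \<omega>) n)" for m n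
    by (rule grid_functional_law_cong[OF M N law, where \<Psi> = "\<lambda>v. psum v n"]) (rule psum_measurable)
  have walk_Min: "distr M borel (\<lambda>\<omega>. Min (psum (\<lambda>i. A.step m i \<omega>) ` {..n}))
      = distr N borel (\<lambda>\<omega>. Min (psum (\<lambda>i. B.step m i \<omega>) ` {..n}))" for m n
    by (rule grid_functional_law_cong[OF M N law, where \<Psi> = "\<lambda>v. Min (psum v ` {..n})"])
      (intro borel_measurable_Min psum_measurable, auto)
  show "A.law_at_expo r A.incr = B.law_at_expo r B.incr"
  proof (rule Levy_uniqueness)
    show "char (A.law_at_expo r A.incr) = char (B.law_at_expo r B.incr)"
    proof
      fix u
      show "char (A.law_at_expo r A.incr) u = char (B.law_at_expo r B.incr) u"
        using A.char_law_at_expo[where Z = "\<lambda>m n \<omega>. psum (\<lambda>i. A.step m i \<omega>) n" and V = A.incr, OF r A.walk_measurable A.walk_tendsto_incr, of u]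
          B.char_law_at_expo[where Z = "\<lambda>m n \<omega>. psum (\<lambda>i. B.step m i \<omega>) n" and V = B.incr, OF r B.walk_measurable B.walk_tendsto_incr, of u]
        unfolding char[OF walk A.walk_measurable B.walk_measurable] by (rule LIMSEQ_unique)
    qed
  qed (intro A.real_distribution_law_at_expo B.real_distribution_law_at_expo r A.incr_measurable B.incr_measurable)+
  show "A.law_at_expo r A.fall = B.law_at_expo r B.fall"
  proof (rule Levy_uniqueness)
    show "char (A.law_at_expo r A.fall) = char (B.law_at_expo r B.fall)"
    proof
      fix u
      show "char (A.law_at_expo r A.fall) u = char (B.law_at_expo r B.fall) u"
        using A.char_law_at_expo[where Z = "\<lambda>m n \<omega>. Min (psum (\<lambda>i. A.step m i \<omega>) ` {..n})" and V = A.fall, OF r A.walk_Min_measurable A.walk_Min_tendsto_fall, of u]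
          B.char_law_at_expo[where Z = "\<lambda>m n \<omega>. Min (psum (\<lambda>i. B.step m i \<omega>) ` {..n})" and V = B.fall, OF r B.walk_Min_measurable B.walk_Min_tendsto_fall, of u]
        unfolding char[OF walk_Min A.walk_Min_measurable B.walk_Min_measurable] by (rule LIMSEQ_unique)
    qed
  qed (intro A.real_distribution_law_at_expo B.real_distribution_law_at_expo r A.fall_measurable B.fall_measurable)+
qed

lemma generated_sets_eq:
  "f \<in> space M \<rightarrow> space N \<Longrightarrow> generated_sets M N f = {f -` A \<inter> space M |A. A \<in> sets N}"
  unfolding generated_sets_def by (rule sets_vimage_algebra2)

lemma generated_sets_comp_subset:
  assumes "f \<in> M \<rightarrow>\<^sub>M N" "h \<in> N \<rightarrow>\<^sub>M N'"
  shows "generated_sets M N' (\<lambda>\<omega>. h (f \<omega>)) \<subseteq> generated_sets M N f"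
proof -
  have f: "f \<in> space M \<rightarrow> space N" and h: "h \<in> space N \<rightarrow> space N'"
    using assms by (auto dest: measurable_space)
  have hf: "(\<lambda>\<omega>. h (f \<omega>)) \<in> space M \<rightarrow> space N'" using f h by auto
  show ?thesis
    unfolding generated_sets_eq[OF f] generated_sets_eq[OF hf]
  proof safe
    fix A assume "A \<in> sets N'"
    then have "h -` A \<inter> space N \<in> sets N" using assms(2) by (rule measurable_sets[rotated])
    moreover have "(\<lambda>\<omega>. h (f \<omega>)) -` A \<inter> space M = f -` (h -` A \<inter> space N) \<inter> space M"
      using f by auto
    ultimately show "\<exists>B. (\<lambda>\<omega>. h (f \<omega>)) -` A \<inter> space M = f -` B \<inter> space M \<and> B \<in> sets N" by blast
  qed
qed

text \<open>
  Independence says that on rectangles the joint law of \<open>T\<close> and of the sample point, the latter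
  observed through the \<open>\<sigma>\<close>-algebra generated by \<open>f\<close>, is a product measure.
\<close>

lemma (in prob_space) law_at_independent_time:
  fixes T :: "'a \<Rightarrow> real" and V :: "real \<Rightarrow> 'a \<Rightarrow> real"
  assumes r: "0 < r" and T: "distributed M lborel T (exponential_density r)"
    and f: "f \<in> M \<rightarrow>\<^sub>M S"
    and indep: "indep_set (generated_sets M borel T) \<G>" "generated_sets M S f \<subseteq> \<G>"
    and V: "(\<lambda>p. V (snd p) (fst p)) \<in> borel_measurable (vimage_algebra (space M) f S \<Otimes>\<^sub>M borel)"
  shows "distr M borel (\<lambda>\<omega>. V (T \<omega>) \<omega>) = distr (M \<Otimes>\<^sub>M expo r) borel (\<lambda>p. V (snd p) (fst p))"
proof -
  interpret E: prob_space "expo r" by (rule prob_space_expo[OF r])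
  define F where "F = vimage_algebra (space M) f S"
  have [simp]: "space F = space M" by (simp add: F_def)
  have id [measurable]: "(\<lambda>\<omega>. \<omega>) \<in> M \<rightarrow>\<^sub>M F"
    unfolding F_def using f by (intro measurable_vimage_algebra2) auto
  have Tm [measurable]: "T \<in> borel_measurable M" using distributed_measurable[OF T] by simp
  have law_T: "distr M borel T = expo r"
  proof -
    have "distr M borel T = distr M lborel T" by (intro distr_cong) auto
    then show ?thesis using distributed_distr_eq_density[OF T] by (simp add: expo_def)
  qed
  have "expo r \<Otimes>\<^sub>M distr M F (\<lambda>\<omega>. \<omega>) = distr M (borel \<Otimes>\<^sub>M F) (\<lambda>\<omega>. (T \<omega>, \<omega>))"
  proof (rule pair_measure_eqI)
    show "sigma_finite_measure (expo r)" by (rule E.sigma_finite_measure_axioms)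
    show "sigma_finite_measure (distr M F (\<lambda>\<omega>. \<omega>))"
      by (intro prob_space_imp_sigma_finite prob_space_distr id)
    show "sets (expo r \<Otimes>\<^sub>M distr M F (\<lambda>\<omega>. \<omega>)) = sets (distr M (borel \<Otimes>\<^sub>M F) (\<lambda>\<omega>. (T \<omega>, \<omega>)))"
      by (simp cong: sets_pair_measure_cong)
    fix A B assume "A \<in> sets (expo r)" and "B \<in> sets (distr M F (\<lambda>\<omega>. \<omega>))"
    then have A: "A \<in> sets borel" and B: "B \<in> sets F" by simp_all
    have BM: "B \<in> sets M" and B_sub: "B \<subseteq> space M"
      using measurable_sets[OF id B] sets.sets_into_space[OF B] by (auto simp: Int_absorb2)
    have "T -` A \<inter> space M \<in> generated_sets M borel T"
      using A by (auto simp: generated_sets_eq)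
    moreover have "B \<in> \<G>" using B indep(2) by (auto simp: F_def generated_sets_def)
    ultimately have "prob ((T -` A \<inter> space M) \<inter> B) = prob (T -` A \<inter> space M) * prob B"
      by (rule indep_setD[OF indep(1)])
    moreover have "emeasure (expo r) A = emeasure M (T -` A \<inter> space M)"
      unfolding law_T[symmetric] using A by (intro emeasure_distr) auto
    moreover have "emeasure (distr M F (\<lambda>\<omega>. \<omega>)) B = emeasure M B"
      using B B_sub by (subst emeasure_distr) (auto simp: Int_absorb2)
    moreover have "emeasure (distr M (borel \<Otimes>\<^sub>M F) (\<lambda>\<omega>. (T \<omega>, \<omega>))) (A \<times> B) = emeasure M ((T -` A \<inter> space M) \<inter> B)"
    proof -
      have "(\<lambda>\<omega>. (T \<omega>, \<omega>)) -` (A \<times> B) \<inter> space M = (T -` A \<inter> space M) \<inter> B" using B_sub by auto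
      then show ?thesis using A B by (subst emeasure_distr) auto
    qed
    ultimately show "emeasure (expo r) A * emeasure (distr M F (\<lambda>\<omega>. \<omega>)) B
        = emeasure (distr M (borel \<Otimes>\<^sub>M F) (\<lambda>\<omega>. (T \<omega>, \<omega>))) (A \<times> B)"
      by (simp add: emeasure_eq_measure ennreal_mult)
  qed
  moreover have "expo r \<Otimes>\<^sub>M distr M F (\<lambda>\<omega>. \<omega>) = distr (expo r \<Otimes>\<^sub>M M) (borel \<Otimes>\<^sub>M F) (\<lambda>(t, \<omega>). (t, \<omega>))"
  proof -
    have "distr (expo r) borel (\<lambda>t. t) \<Otimes>\<^sub>M distr M F (\<lambda>\<omega>. \<omega>) = distr (expo r \<Otimes>\<^sub>M M) (borel \<Otimes>\<^sub>M F) (\<lambda>(t, \<omega>). (t, \<omega>))"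
      by (intro pair_measure_distr prob_space_imp_sigma_finite prob_space_distr id) simp
    moreover have "distr (expo r) borel (\<lambda>t. t) = expo r" by (intro distr_id2) simp
    ultimately show ?thesis by simp
  qed
  ultimately have joint: "distr M (borel \<Otimes>\<^sub>M F) (\<lambda>\<omega>. (T \<omega>, \<omega>)) = distr (expo r \<Otimes>\<^sub>M M) (borel \<Otimes>\<^sub>M F) (\<lambda>p. p)"
    by (simp add: split_def)
  have V' [measurable]: "(\<lambda>p. V (fst p) (snd p)) \<in> borel_measurable (borel \<Otimes>\<^sub>M F)"
    using measurable_compose[OF measurable_pair_swap' V[folded F_def]] by (simp add: split_def)
  have idp: "(\<lambda>p. p) \<in> expo r \<Otimes>\<^sub>M M \<rightarrow>\<^sub>M borel \<Otimes>\<^sub>M F"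
    by (rule measurable_pair) (auto simp: comp_def intro: measurable_compose[OF measurable_snd id] measurable_compose[OF measurable_fst])
  have "distr M borel (\<lambda>\<omega>. V (T \<omega>) \<omega>) = distr (distr M (borel \<Otimes>\<^sub>M F) (\<lambda>\<omega>. (T \<omega>, \<omega>))) borel (\<lambda>p. V (fst p) (snd p))"
    by (subst distr_distr) (auto simp: comp_def)
  also have "\<dots> = distr (expo r \<Otimes>\<^sub>M M) borel (\<lambda>p. V (fst p) (snd p))"
    unfolding joint by (subst distr_distr[OF V' idp]) (simp add: comp_def)
  also have "\<dots> = distr (M \<Otimes>\<^sub>M expo r) borel (\<lambda>p. V (snd p) (fst p))"
  proof -
    interpret Q: pair_sigma_finite "expo r" M
      by (intro pair_sigma_finite.intro E.sigma_finite_measure_axioms sigma_finite_measure_axioms)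
    have "(\<lambda>p. V (fst p) (snd p)) \<in> borel_measurable (expo r \<Otimes>\<^sub>M M)"
      using measurable_compose[OF idp V'] by simp
    then show ?thesis
      by (subst Q.distr_pair_swap, subst distr_distr) (auto simp: comp_def split_def measurable_pair_swap')
  qed
  finally show ?thesis .
qed

section \<open>Averages over the infimum and discounted running suprema\<close>

lemma cadlag_mono_SUP:
  fixes f k :: "real \<Rightarrow> real"
  assumes f: "cadlag f" and k: "mono k" "continuous_on UNIV k" and t: "0 \<le> t"
  shows "(SUP s\<in>{0..t}. k (f s)) = k (SUP s\<in>{0..t}. f s)"
proof -
  have "continuous (at_left (Sup (f ` {0..t}))) k"
    using k(2) by (simp add: continuous_on_eq_continuous_at continuous_at_imp_continuous_at_within)
  then have "k (Sup (f ` {0..t})) = (SUP z\<in>f ` {0..t}. k z)"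
    using t by (intro continuous_at_Sup_mono k(1) cadlag_bdd_above f) auto
  then show ?thesis by (simp add: image_image)
qed

lemma mono_average:
  fixes g :: "real \<Rightarrow> real"
  assumes g: "mono g" and int: "\<And>y. integrable \<nu> (\<lambda>i. g (y + i))"
  shows "mono (\<lambda>y. \<integral>i. g (y + i) \<partial>\<nu>)"
  by (intro monoI integral_mono int monoD[OF g]) simp

text \<open>
  Near a point, monotonicity bounds \<open>g (z + i)\<close> by its values at two fixed shifts, which are
  integrable.
\<close>

lemma continuous_on_average:
  fixes g :: "real \<Rightarrow> real"
  assumes g: "mono g" "continuous_on UNIV g" and int: "\<And>y. integrable \<nu> (\<lambda>i. g (y + i))"
  shows "continuous_on UNIV (\<lambda>y. \<integral>i. g (y + i) \<partial>\<nu>)"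
proof (rule continuous_at_imp_continuous_on, intro ballI)
  fix y :: real
  show "isCont (\<lambda>y. \<integral>i. g (y + i) \<partial>\<nu>) y"
    unfolding continuous_at_sequentially comp_def
  proof (intro allI impI)
    fix z :: "nat \<Rightarrow> real" assume z: "z \<longlonglongrightarrow> y"
    then have "Bseq z" by (intro convergent_imp_Bseq convergentI)
    then obtain C where C: "\<And>n. \<bar>z n\<bar> \<le> C" by (auto simp: Bseq_def)
    show "(\<lambda>n. \<integral>i. g (z n + i) \<partial>\<nu>) \<longlonglongrightarrow> (\<integral>i. g (y + i) \<partial>\<nu>)"
    proof (rule integral_dominated_convergence[where w = "\<lambda>i. \<bar>g (- C + i)\<bar> + \<bar>g (C + i)\<bar>"])
      show "integrable \<nu> (\<lambda>i. \<bar>g (- C + i)\<bar> + \<bar>g (C + i)\<bar>)"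
        by (intro Bochner_Integration.integrable_add integrable_abs int)
      show "AE i in \<nu>. (\<lambda>n. g (z n + i)) \<longlonglongrightarrow> g (y + i)"
        by (intro AE_I2 continuous_on_UNIV_tendsto[OF g(2)] tendsto_add z tendsto_const)
      show "AE i in \<nu>. norm (g (z n + i)) \<le> \<bar>g (- C + i)\<bar> + \<bar>g (C + i)\<bar>" for n
      proof (intro AE_I2)
        fix i
        have "g (- C + i) \<le> g (z n + i)" "g (z n + i) \<le> g (C + i)"
          using C[of n] by (auto intro!: monoD[OF g(1)])
        then show "norm (g (z n + i)) \<le> \<bar>g (- C + i)\<bar> + \<bar>g (C + i)\<bar>" by (simp add: abs_if)
      qed
    qed (use int in \<open>auto intro: borel_measurable_integrable\<close>)
  qed
qed

context levy
begin

lemma fall_nonpos: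
  assumes "\<omega> \<in> space M"
  shows "fall t \<omega> \<le> 0"
proof -
  have "(INF s\<in>{0..max 0 t}. X s \<omega>) \<le> X 0 \<omega>"
    by (rule cINF_lower[OF cadlag_bdd_below[OF X_cadlag[OF assms]]]) simp
  then show ?thesis by (simp add: fall_def running_inf_def)
qed

lemma AE_law_fall_nonpos:
  assumes r: "0 < r"
  shows "AE i in law_at_expo r fall. i \<le> 0"
proof -
  have m: "(\<lambda>p. fall (snd p) (fst p)) \<in> borel_measurable (M \<Otimes>\<^sub>M expo r)"
    unfolding measurable_pair_expo by (rule fall_measurable)
  show ?thesis
    unfolding law_at_expo_def
    by (subst AE_distr_iff[OF m]) (auto intro!: AE_I2 fall_nonpos simp: space_pair_measure)
qed

text \<open>
  By the factorization and Fubini, \<open>i \<mapsto> g (y - n + s + i)\<close> is integrable for almost every value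
  \<open>s\<close> of the supremum. Choosing \<open>n\<close> such that the supremum is at most \<open>n\<close> with positive
  probability gives such an \<open>s \<le> n\<close>, hence an integrable lower bound for \<open>g (y + i)\<close>; as the infimum
  is nonpositive, \<open>g y\<close> is an upper bound.
\<close>

lemma integrable_fall_shift:
  fixes g :: "real \<Rightarrow> real"
  assumes r: "0 < r" and g: "mono g" "g \<in> borel_measurable borel"
    and int: "\<And>y. integrable (law_at_expo r incr) (\<lambda>z. g (y + z))"
  shows "integrable (law_at_expo r fall) (\<lambda>i. g (y + i))"
proof -
  note [measurable] = g(2)
  interpret S: real_distribution "law_at_expo r rise"
    by (rule real_distribution_law_at_expo[OF r rise_measurable])
  interpret I: real_distribution "law_at_expo r fall"
    by (rule real_distribution_law_at_expo[OF r fall_measurable])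
  interpret SI: pair_prob_space "law_at_expo r rise" "law_at_expo r fall" ..
  \<comment> \<open>The supremum is finite, so it is at most \<open>n\<close> with positive probability for some \<open>n\<close>.\<close>
  have "\<exists>n :: nat. \<not> (AE s in law_at_expo r rise. real n < s)"
  proof (rule ccontr)
    assume "\<not> ?thesis"
    then have "AE s in law_at_expo r rise. \<forall>n :: nat. real n < s" by (simp add: AE_all_countable)
    then have "AE s in law_at_expo r rise. False"
      by eventually_elim (meson less_asym' reals_Archimedean2)
    then show False by simp
  qed
  then obtain n :: nat where n: "\<not> (AE s in law_at_expo r rise. real n < s)" by blast
  have "integrable (law_at_expo r rise \<Otimes>\<^sub>M law_at_expo r fall) (\<lambda>p. g (y - real n + (fst p + snd p)))"
    using int[of "y - real n"] unfolding Wiener_Hopf_factorization[OF r]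
    by (subst (asm) integrable_distr_eq) auto
  from SI.AE_integrable_fst'[OF this]
  have "AE s in law_at_expo r rise. integrable (law_at_expo r fall) (\<lambda>i. g (y - real n + (s + i)))"
    by simp
  then have "\<exists>s. s \<le> real n \<and> integrable (law_at_expo r fall) (\<lambda>i. g (y - real n + (s + i)))"
    using n by (metis (mono_tags, lifting) eventually_mono not_less)
  then obtain s where s: "s \<le> real n" "integrable (law_at_expo r fall) (\<lambda>i. g (y - real n + (s + i)))"
    by blast
  show ?thesis
  proof (rule Bochner_Integration.integrable_bound)
    show "integrable (law_at_expo r fall) (\<lambda>i. \<bar>g (y - real n + (s + i))\<bar> + \<bar>g y\<bar>)"
      using s(2) by simp
    show "AE i in law_at_expo r fall. norm (g (y + i)) \<le> norm (\<bar>g (y - real n + (s + i))\<bar> + \<bar>g y\<bar>)"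
      using AE_law_fall_nonpos[OF r]
    proof eventually_elim
      case (elim i)
      have "g (y - real n + (s + i)) \<le> g (y + i)" "g (y + i) \<le> g y"
        using s(1) elim by (auto intro!: monoD[OF g(1)])
      then show ?case by (simp add: abs_if)
    qed
  qed measurable
qed

text \<open>Fubini for the factorization: first average over the infimum, then over the supremum.\<close>

lemma integral_rise_average:
  fixes g :: "real \<Rightarrow> real"
  assumes r: "0 < r" and g: "g \<in> borel_measurable borel"
    and int: "integrable (law_at_expo r incr) (\<lambda>z. g (y + z))"
  defines "k \<equiv> \<lambda>z. \<integral>i. g (z + i) \<partial>law_at_expo r fall"
  shows "integrable (law_at_expo r rise) (\<lambda>s. k (y + s))"
    and "(\<integral>s. k (y + s) \<partial>law_at_expo r rise) = (\<integral>z. g (y + z) \<partial>law_at_expo r incr)"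
proof -
  note [measurable] = g
  interpret S: real_distribution "law_at_expo r rise"
    by (rule real_distribution_law_at_expo[OF r rise_measurable])
  interpret I: real_distribution "law_at_expo r fall"
    by (rule real_distribution_law_at_expo[OF r fall_measurable])
  interpret SI: pair_prob_space "law_at_expo r rise" "law_at_expo r fall" ..
  have i: "integrable (law_at_expo r rise \<Otimes>\<^sub>M law_at_expo r fall) (\<lambda>p. g (y + (fst p + snd p)))"
    using int unfolding Wiener_Hopf_factorization[OF r]
    by (subst (asm) integrable_distr_eq) auto
  show "integrable (law_at_expo r rise) (\<lambda>s. k (y + s))"
    using SI.integrable_fst'[OF i] by (simp add: k_def add.assoc)
  show "(\<integral>s. k (y + s) \<partial>law_at_expo r rise) = (\<integral>z. g (y + z) \<partial>law_at_expo r incr)"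
    using SI.integral_fst'[OF i] unfolding Wiener_Hopf_factorization[OF r]
    by (simp add: k_def add.assoc integral_distr)
qed

lemma integral_law_at_expo:
  fixes h :: "real \<Rightarrow> real"
  assumes "(\<lambda>p. V (snd p) (fst p)) \<in> borel_measurable (M \<Otimes>\<^sub>M borel)" "h \<in> borel_measurable borel"
  shows "integrable (law_at_expo r V) h \<longleftrightarrow> integrable (M \<Otimes>\<^sub>M expo r) (\<lambda>p. h (V (snd p) (fst p)))"
    and "integral\<^sup>L (law_at_expo r V) h = (\<integral>p. h (V (snd p) (fst p)) \<partial>(M \<Otimes>\<^sub>M expo r))"
proof -
  have "(\<lambda>p. V (snd p) (fst p)) \<in> borel_measurable (M \<Otimes>\<^sub>M expo r)"
    using assms(1) by (simp only: measurable_pair_expo)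
  then show "integrable (law_at_expo r V) h \<longleftrightarrow> integrable (M \<Otimes>\<^sub>M expo r) (\<lambda>p. h (V (snd p) (fst p)))"
    and "integral\<^sup>L (law_at_expo r V) h = (\<integral>p. h (V (snd p) (fst p)) \<partial>(M \<Otimes>\<^sub>M expo r))"
    unfolding law_at_expo_def using assms(2) by (simp_all add: integrable_distr_eq integral_distr)
qed

lemma discounted_integral_incr:
  fixes g :: "real \<Rightarrow> real"
  assumes r: "0 < r" and g: "mono g" "continuous_on UNIV g"
    and fin: "finite_mean_time_integral M (\<lambda>t \<omega>. g (X t \<omega>) * exp (- r * t))"
  shows "integrable (law_at_expo r incr) (\<lambda>z. g (x + z))"
    and "mean_time_integral M (\<lambda>t \<omega>. g (X t \<omega>) * exp (- r * t)) = (1 / r) * (\<integral>z. g (x + z) \<partial>law_at_expo r incr)"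
proof -
  interpret Q: pair_prob_space M "expo r" by (rule pair_expo[OF r])
  note gm [measurable] = borel_measurable_continuous_onI[OF g(2)]
  have sec: "(\<lambda>t. g (x + incr t \<omega>)) \<in> borel_measurable borel" if "\<omega> \<in> space M" for \<omega>
    using incr_section_measurable[OF that] by measurable
  have pt: "r * (g (X t \<omega>) * exp (- r * t)) = g (x + incr t \<omega>) * (r * exp (- r * t))"
    if "X 0 \<omega> = x" "t \<in> {0..}" for t \<omega>
    using that by (simp add: incr_def max_def)
  have path: "AE \<omega> in M. integrable (expo r) (\<lambda>t. g (x + incr t \<omega>))"
  proof -
    from fin have "AE \<omega> in M. set_integrable lborel {0..} (\<lambda>t. g (X t \<omega>) * exp (- r * t))"
      by (simp add: finite_mean_time_integral_def)
    then show ?thesis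
      using X_start AE_space
    proof eventually_elim
      case (elim \<omega>)
      then have "set_integrable lborel {0..} (\<lambda>t. r * (g (X t \<omega>) * exp (- r * t)))"
        by (intro set_integrable_mult_right) simp
      also have "?this \<longleftrightarrow> set_integrable lborel {0..} (\<lambda>t. g (x + incr t \<omega>) * (r * exp (- r * t)))"
        by (intro set_integrable_cong refl pt[OF elim(2)])
      finally show ?case using integrable_expo[OF r sec[OF elim(3)]] by simp
    qed
  qed
  have val: "AE \<omega> in M. (LINT t:{0..}|lborel. g (X t \<omega>) * exp (- r * t)) = (1 / r) * (\<integral>t. g (x + incr t \<omega>) \<partial>expo r)"
    using X_start AE_space
  proof eventually_elim
    case (elim \<omega>)
    have "(\<integral>t. g (x + incr t \<omega>) \<partial>expo r) = (LINT t:{0..}|lborel. r * (g (X t \<omega>) * exp (- r * t)))"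
      unfolding integral_expo[OF r sec[OF elim(2)]]
      by (intro set_lebesgue_integral_cong allI impI pt[OF elim(1), symmetric]) auto
    also have "\<dots> = r * (LINT t:{0..}|lborel. g (X t \<omega>) * exp (- r * t))" by simp
    finally show ?case using r by simp
  qed
  have meas: "(\<lambda>p. g (x + incr (snd p) (fst p))) \<in> borel_measurable (M \<Otimes>\<^sub>M expo r)"
    unfolding measurable_pair_expo using incr_measurable by measurable
  have Jm: "(\<lambda>\<omega>. \<integral>t. g (x + incr t \<omega>) \<partial>expo r) \<in> borel_measurable M"
    using Q.M2.borel_measurable_lebesgue_integral[of "\<lambda>\<omega> t. g (x + incr t \<omega>)" M] meas by (simp add: split_def)
  have "integrable M (\<lambda>\<omega>. LINT t:{0..}|lborel. g (X t \<omega>) * exp (- r * t))"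
    using fin by (simp add: finite_mean_time_integral_def)
  then have "integrable M (\<lambda>\<omega>. r * (LINT t:{0..}|lborel. g (X t \<omega>) * exp (- r * t)))" by simp
  then have J: "integrable M (\<lambda>\<omega>. \<integral>t. g (x + incr t \<omega>) \<partial>expo r)"
    by (rule integrable_cong_AE_imp[OF _ Jm]) (use val r in \<open>auto elim!: eventually_mono\<close>)
  have "mono (\<lambda>z. g (x + z))" by (intro monoI monoD[OF g(1)]) simp
  moreover have "continuous_on UNIV (\<lambda>z. g (x + z))"
    by (rule continuous_on_compose2[OF g(2)]) (auto intro!: continuous_intros)
  ultimately have int: "integrable (M \<Otimes>\<^sub>M expo r) (\<lambda>p. g (x + incr (snd p) (fst p)))"
    by (rule integrable_of_iterated[OF r _ _ path J])
  then show "integrable (law_at_expo r incr) (\<lambda>z. g (x + z))"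
    by (subst integral_law_at_expo[OF incr_measurable]) auto
  have "mean_time_integral M (\<lambda>t \<omega>. g (X t \<omega>) * exp (- r * t)) = expectation (\<lambda>\<omega>. (1 / r) * (\<integral>t. g (x + incr t \<omega>) \<partial>expo r))"
    unfolding mean_time_integral_def
    using \<open>integrable M (\<lambda>\<omega>. LINT t:{0..}|lborel. g (X t \<omega>) * exp (- r * t))\<close> Jm val
    by (intro integral_cong_AE) auto
  also have "\<dots> = (1 / r) * (\<integral>z. g (x + z) \<partial>law_at_expo r incr)"
    using Q.integral_fst'[OF int] by (simp add: integral_law_at_expo(2)[OF incr_measurable])
  finally show "mean_time_integral M (\<lambda>t \<omega>. g (X t \<omega>) * exp (- r * t)) = (1 / r) * (\<integral>z. g (x + z) \<partial>law_at_expo r incr)" .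
qed

text \<open>
  As \<open>k\<close> is increasing and continuous, the running supremum of \<open>k (X s)\<close> is \<open>k\<close> of the running
  supremum, so the discounted integral is an expectation at an exponential time.
\<close>

lemma discounted_integral_running_sup:
  fixes k :: "real \<Rightarrow> real"
  assumes r: "0 < r" and k: "mono k" "continuous_on UNIV k"
    and int: "integrable (law_at_expo r rise) (\<lambda>s. k (x + s))"
  defines "R \<equiv> \<lambda>t \<omega>. running_sup (\<lambda>s \<omega>. k (X s \<omega>)) t \<omega> * (r * exp (- r * t))"
  shows "finite_mean_time_integral M R"
    and "mean_time_integral M R = (\<integral>s. k (x + s) \<partial>law_at_expo r rise)"
proof -
  interpret Q: pair_prob_space M "expo r" by (rule pair_expo[OF r])
  note [measurable] = borel_measurable_continuous_onI[OF k(2)]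
  define H where "H p = k (X 0 (fst p) + rise (snd p) (fst p))" for p
  have Xm [measurable]: "(\<lambda>p. X 0 (fst p)) \<in> borel_measurable (M \<Otimes>\<^sub>M expo r)"
    by (rule measurable_compose[OF measurable_fst X_0_measurable])
  have Sm [measurable]: "(\<lambda>p. rise (snd p) (fst p)) \<in> borel_measurable (M \<Otimes>\<^sub>M expo r)"
    unfolding measurable_pair_expo by (rule rise_measurable)
  have Hm: "H \<in> borel_measurable (M \<Otimes>\<^sub>M expo r)" unfolding H_def[abs_def] by measurable
  have start: "AE p in M \<Otimes>\<^sub>M expo r. X 0 (fst p) = x"
  proof (rule Q.AE_pair_measure)
    show "{p \<in> space (M \<Otimes>\<^sub>M expo r). X 0 (fst p) = x} \<in> sets (M \<Otimes>\<^sub>M expo r)" by measurable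
    show "AE \<omega> in M. AE t in expo r. X 0 (fst (\<omega>, t)) = x" using X_start by eventually_elim simp
  qed
  have HAE: "AE p in M \<Otimes>\<^sub>M expo r. k (x + rise (snd p) (fst p)) = H p"
    using start by eventually_elim (simp add: H_def)
  have km: "(\<lambda>s. k (x + s)) \<in> borel_measurable borel" by measurable
  have "integrable (M \<Otimes>\<^sub>M expo r) (\<lambda>p. k (x + rise (snd p) (fst p)))"
    using int integral_law_at_expo(1)[OF rise_measurable km] by simp
  then have Hint: "integrable (M \<Otimes>\<^sub>M expo r) H"
    by (rule integrable_cong_AE_imp[OF _ Hm HAE])
  have Hval: "integral\<^sup>L (M \<Otimes>\<^sub>M expo r) H = (\<integral>s. k (x + s) \<partial>law_at_expo r rise)"
    unfolding integral_law_at_expo(2)[OF rise_measurable km]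
    by (rule integral_cong_AE[OF Hm]) (measurable, use HAE in \<open>auto elim!: eventually_mono\<close>)
  have R: "R t \<omega> = H (\<omega>, t) * (r * exp (- r * t))" if "\<omega> \<in> space M" "t \<in> {0..}" for t \<omega>
    using that cadlag_mono_SUP[OF X_cadlag[OF that(1)] k, of t]
    by (simp add: R_def H_def rise_def running_sup_def max_def)
  have sec: "(\<lambda>t. H (\<omega>, t)) \<in> borel_measurable borel" if "\<omega> \<in> space M" for \<omega>
    using measurable_compose[OF measurable_Pair1'[OF that] Hm] by (simp cong: measurable_cong_sets)
  have Rint: "set_integrable lborel {0..} (\<lambda>t. R t \<omega>) \<longleftrightarrow> integrable (expo r) (\<lambda>t. H (\<omega>, t))"
    if "\<omega> \<in> space M" for \<omega>
    unfolding integrable_expo[OF r sec[OF that]] using R[OF that] by (intro set_integrable_cong) auto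
  have Rval: "(LINT t:{0..}|lborel. R t \<omega>) = (\<integral>t. H (\<omega>, t) \<partial>expo r)" if "\<omega> \<in> space M" for \<omega>
    unfolding integral_expo[OF r sec[OF that]] using R[OF that] by (intro set_lebesgue_integral_cong) auto
  have "AE \<omega> in M. set_integrable lborel {0..} (\<lambda>t. R t \<omega>)"
    using Q.AE_integrable_fst'[OF Hint] AE_space by eventually_elim (simp add: Rint)
  moreover have "integrable M (\<lambda>\<omega>. LINT t:{0..}|lborel. R t \<omega>)"
    using Q.integrable_fst'[OF Hint] by (simp add: Rval cong: Bochner_Integration.integrable_cong)
  ultimately show "finite_mean_time_integral M R" by (simp add: finite_mean_time_integral_def)
  show "mean_time_integral M R = (\<integral>s. k (x + s) \<partial>law_at_expo r rise)"
    unfolding mean_time_integral_def Hval[symmetric] Q.integral_fst'[OF Hint, symmetric]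
    by (intro Bochner_Integration.integral_cong refl Rval)
qed

end

section \<open>The representation and the reflection of decreasing functions\<close>

lemma levy_process_uminus:
  assumes L: "levy_process M X x"
  shows "levy_process M (\<lambda>t \<omega>. - X t \<omega>) (- x)"
proof -
  interpret levy M X x by (rule levyI[OF L])
  have increments: "indep_vars (\<lambda>_. borel) (\<lambda>i \<omega>. - X (t (Suc i)) \<omega> - - X (t i) \<omega>) {..<n}"
    if "0 \<le> t 0" "mono t" for n :: nat and t
  proof -
    have "indep_vars (\<lambda>_. borel) (\<lambda>i \<omega>. X (t (Suc i)) \<omega> - X (t i) \<omega>) {..<n}"
      using L that unfolding levy_process_def by blast
    from indep_vars_compose2[OF this, of "\<lambda>_ z. - z" "\<lambda>_. borel"]
    show ?thesis by (simp add: algebra_simps)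
  qed
  have stationary: "distr M borel (\<lambda>\<omega>. - X (s + h) \<omega> - - X s \<omega>) = distr M borel (\<lambda>\<omega>. - X h \<omega> - - X 0 \<omega>)"
    if sh: "0 \<le> s" "0 \<le> h" for s h
  proof -
    have neg: "distr M borel (\<lambda>\<omega>. - X a \<omega> - - X b \<omega>) = distr (distr M borel (\<lambda>\<omega>. X a \<omega> - X b \<omega>)) borel uminus"
      if "0 \<le> a" "0 \<le> b" for a b
      using X_measurable[OF that(1)] X_measurable[OF that(2)]
      by (subst distr_distr) (auto simp: comp_def)
    have "distr M borel (\<lambda>\<omega>. X (s + h) \<omega> - X s \<omega>) = distr M borel (\<lambda>\<omega>. X h \<omega> - X 0 \<omega>)"
      using L sh unfolding levy_process_def by blast
    then show ?thesis using sh by (simp only: neg add_nonneg_nonneg order_refl)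
  qed
  have start: "AE \<omega> in M. - X 0 \<omega> = - x" using X_start by simp
  show ?thesis
    unfolding levy_process_def
    using increments stationary start
    by (auto intro!: prob_space_axioms X_measurable borel_measurable_uminus cadlag_uminus X_cadlag)
qed

lemma uminus_path_measurable: "(\<lambda>p. \<lambda>t\<in>{0..}. - p t) \<in> path_space \<rightarrow>\<^sub>M path_space"
  unfolding path_space_def by (intro measurable_restrict borel_measurable_uminus measurable_component_singleton)

lemma path_uminus: "path (\<lambda>t \<omega>. - X t \<omega>) \<omega> = (\<lambda>t\<in>{0..}. - path X \<omega> t)"
  by (auto simp: path_def)

lemma path_law_uminus:
  assumes "path X \<in> M \<rightarrow>\<^sub>M path_space" "path Y \<in> N \<rightarrow>\<^sub>M path_space"
    and "distr M path_space (path X) = distr N path_space (path Y)"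
  shows "distr M path_space (path (\<lambda>t \<omega>. - X t \<omega>)) = distr N path_space (path (\<lambda>t \<omega>. - Y t \<omega>))"
proof -
  have *: "distr L path_space (path (\<lambda>t \<omega>. - Z t \<omega>)) = distr (distr L path_space (path Z)) path_space (\<lambda>p. \<lambda>t\<in>{0..}. - p t)"
    if "path Z \<in> L \<rightarrow>\<^sub>M path_space" for L and Z :: "real \<Rightarrow> 'c \<Rightarrow> real"
    by (subst distr_distr[OF uminus_path_measurable that]) (simp add: comp_def path_uminus[abs_def])
  show ?thesis
    using *[OF assms(1)] assms(3)
    by (subst distr_distr[OF uminus_path_measurable assms(2), unfolded comp_def, folded path_uminus] | simp)+
qed

lemma levy_family_levy: "levy_family P X \<Longrightarrow> levy (P x) X x"
  unfolding levy_family_def by (blast intro: levyI)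

lemma levy_family_uminus:
  assumes F: "levy_family P X"
  shows "levy_family (\<lambda>x. P (- x)) (\<lambda>t \<omega>. - X t \<omega>)"
  unfolding levy_family_def
proof (intro allI conjI)
  fix x
  have "levy_process (P (- x)) X (- x)" using F unfolding levy_family_def by blast
  from levy_process_uminus[OF this] show "levy_process (P (- x)) (\<lambda>t \<omega>. - X t \<omega>) x" by simp
  interpret A: levy "P (- x)" X "- x" by (rule levy_family_levy[OF F])
  interpret B: levy "P 0" X 0 by (rule levy_family_levy[OF F])
  have "distr (P (- x)) path_space (path (\<lambda>t \<omega>. - X t \<omega>)) = distr (P 0) path_space (path (\<lambda>t \<omega>. - (- x + X t \<omega>)))"
  proof (rule path_law_uminus)
    show "distr (P (- x)) path_space (path X) = distr (P 0) path_space (path (\<lambda>t \<omega>. - x + X t \<omega>))"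
      using F unfolding levy_family_def by blast
  qed (intro path_measurable borel_measurable_add borel_measurable_const A.X_measurable B.X_measurable; assumption)+
  then show "distr (P (- x)) path_space (path (\<lambda>t \<omega>. - X t \<omega>)) = distr (P (- 0)) path_space (path (\<lambda>t \<omega>. x + - X t \<omega>))"
    by simp
qed

text \<open>
  By the Wiener-Hopf factorization, averaging \<open>g\<close> over the infimum first gives \<open>r\<close> times \<open>kappa\<close>
  evaluated at the supremum, and the law of the infimum at the independent time \<open>T\<close> of the copy is that
  of the infimum of the process itself.
\<close>

theorem increasing_payoff_representation:
  fixes P :: "real \<Rightarrow> 'a measure" and g :: "real \<Rightarrow> real"
  assumes r: "0 < r" and X: "levy_family P X" and X': "levy_family P X'"
    and copy: "distr (P 0) path_space (path X') = distr (P 0) path_space (path X)"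
    and T: "distributed (P 0) lborel T (exponential_density r)"
    and indep: "prob_space.indep_set (P 0) (generated_sets (P 0) borel T) (generated_sets (P 0) path_space (path X'))"
    and g: "mono g" "continuous_on UNIV g"
    and fin: "\<And>x. finite_mean_time_integral (P x) (\<lambda>t \<omega>. g (X t \<omega>) * exp (- r * t))"
  defines "R \<equiv> \<lambda>t \<omega>. running_sup (\<lambda>s \<omega>. kappa P X' T r g (X s \<omega>)) t \<omega> * (r * exp (- r * t))"
  shows "integrable (P 0) (\<lambda>\<omega>. g (y + running_inf X' (T \<omega>) \<omega>))"
    and "finite_mean_time_integral (P x) R"
    and "mean_time_integral (P x) R = mean_time_integral (P x) (\<lambda>t \<omega>. g (X t \<omega>) * exp (- r * t))"
proof -
  interpret A: levy "P x" X x for x by (rule levy_family_levy[OF X])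
  interpret B: levy "P 0" X' 0 by (rule levy_family_levy[OF X'])
  note gm [measurable] = borel_measurable_continuous_onI[OF g(2)]
  define \<nu> where "\<nu> = A.law_at_expo 0 r (levy.fall X)"
  have family: "distr (P x) path_space (path X) = distr (P 0) path_space (path (\<lambda>t \<omega>. x + X t \<omega>))" for x
    using X unfolding levy_family_def by blast
  have fall_law: "A.law_at_expo x r (levy.fall X) = \<nu>" for x
    unfolding \<nu>_def by (rule law_at_expo_cong(2)[OF A.levy_axioms A.levy_axioms r family])
  have incr_law: "A.law_at_expo x r (levy.incr X) = A.law_at_expo z r (levy.incr X)" for x z
    using law_at_expo_cong(1)[OF A.levy_axioms A.levy_axioms r family, of x]
      law_at_expo_cong(1)[OF A.levy_axioms A.levy_axioms r family, of z] by simp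
  have fall_law': "B.law_at_expo r (levy.fall X') = \<nu>"
    unfolding \<nu>_def
    by (rule law_at_expo_cong(2)[OF B.levy_axioms A.levy_axioms r, where d = 0]) (use copy in simp)
  have int_incr: "integrable (A.law_at_expo x r (levy.incr X)) (\<lambda>z. g (y + z))" for x y
    using A.discounted_integral_incr(1)[OF r g fin] incr_law[of x y] by simp
  have int_fall: "integrable \<nu> (\<lambda>i. g (y + i))" for y
    unfolding \<nu>_def by (rule A.integrable_fall_shift[OF r g(1) gm int_incr])
  have Tm [measurable]: "T \<in> borel_measurable (P 0)" using distributed_measurable[OF T] by simp
  have law_T: "distr (P 0) borel (\<lambda>\<omega>. B.fall (T \<omega>) \<omega>) = \<nu>"
  proof -
    have "distr (P 0) borel (\<lambda>\<omega>. B.fall (T \<omega>) \<omega>) = distr (P 0 \<Otimes>\<^sub>M expo r) borel (\<lambda>p. B.fall (snd p) (fst p))"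
    proof (rule prob_space.law_at_independent_time[OF A.prob_space_axioms r T _ indep order_refl])
      show pX: "path X' \<in> P 0 \<rightarrow>\<^sub>M path_space" by (rule path_measurable[OF B.X_measurable])
      show "(\<lambda>p. B.fall (snd p) (fst p)) \<in> borel_measurable (vimage_algebra (space (P 0)) (path X') path_space \<Otimes>\<^sub>M borel)"
      proof (rule B.fall_measurable_subalgebra)
        fix t :: real assume "0 \<le> t"
        then have "(\<lambda>\<omega>. path X' \<omega> t) \<in> borel_measurable (vimage_algebra (space (P 0)) (path X') path_space)"
          using measurable_space[OF pX]
          by (intro measurable_compose[OF measurable_vimage_algebra1[of "path X'"], where g = "\<lambda>p. p t"])
            (auto simp: path_space_def intro!: measurable_component_singleton)
        moreover have "(\<lambda>\<omega>. path X' \<omega> t) = X' t" using \<open>0 \<le> t\<close> by (auto simp: path_def)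
        ultimately show "X' t \<in> borel_measurable (vimage_algebra (space (P 0)) (path X') path_space)" by simp
      qed simp
    qed
    then show ?thesis by (simp add: fall_law'[symmetric] B.law_at_expo_def)
  qed
  have fall_T_measurable [measurable]: "(\<lambda>\<omega>. B.fall (T \<omega>) \<omega>) \<in> borel_measurable (P 0)"
    using measurable_compose[OF measurable_Pair[OF measurable_ident_sets[OF refl] Tm] B.fall_measurable] by simp
  have T_nonneg: "AE \<omega> in P 0. 0 \<le> T \<omega>"
  proof (rule AE_distrD[OF distributed_measurable[OF T]])
    show "AE t in distr (P 0) lborel T. 0 \<le> t"
      unfolding distributed_distr_eq_density[OF T] expo_def[symmetric] by (rule AE_expo_nonneg)
  qed
  have AE_T: "AE \<omega> in P 0. running_inf X' (T \<omega>) \<omega> = B.fall (T \<omega>) \<omega>"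
    using T_nonneg B.X_start by eventually_elim (simp add: B.fall_def max_def)
  \<comment> \<open>At a negative time the infimum is taken over the empty set and has an unspecified constant value.\<close>
  have inf_measurable: "(\<lambda>\<omega>. running_inf X' (T \<omega>) \<omega>) \<in> borel_measurable (P 0)"
  proof -
    have "(\<lambda>\<omega>. running_inf X' (T \<omega>) \<omega>)
      = (\<lambda>\<omega>. if 0 \<le> T \<omega> then B.fall (T \<omega>) \<omega> + X' 0 \<omega> else Inf {})"
      by (auto simp: B.fall_def running_inf_def max_def fun_eq_iff)
    then show ?thesis by simp
  qed
  have int_T: "integrable (P 0) (\<lambda>\<omega>. g (y + B.fall (T \<omega>) \<omega>))"
    and val_T: "(\<integral>\<omega>. g (y + B.fall (T \<omega>) \<omega>) \<partial>P 0) = (\<integral>i. g (y + i) \<partial>\<nu>)" for y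
    using int_fall[of y] unfolding law_T[symmetric]
    by (simp_all add: integrable_distr_eq integral_distr)
  have AE_g: "AE \<omega> in P 0. g (y + B.fall (T \<omega>) \<omega>) = g (y + running_inf X' (T \<omega>) \<omega>)" for y
    using AE_T by eventually_elim simp
  have gT_measurable: "(\<lambda>\<omega>. g (y + running_inf X' (T \<omega>) \<omega>)) \<in> borel_measurable (P 0)" for y
    using inf_measurable by measurable
  show "integrable (P 0) (\<lambda>\<omega>. g (y + running_inf X' (T \<omega>) \<omega>))"
    by (rule integrable_cong_AE_imp[OF int_T gT_measurable AE_g])
  have kappa: "kappa P X' T r g = (\<lambda>y. (1 / r) * (\<integral>i. g (y + i) \<partial>\<nu>))"
  proof
    fix y
    have "(\<integral>\<omega>. g (y + running_inf X' (T \<omega>) \<omega>) \<partial>P 0) = (\<integral>\<omega>. g (y + B.fall (T \<omega>) \<omega>) \<partial>P 0)"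
      using AE_g[of y] by (intro integral_cong_AE gT_measurable) (measurable, auto elim!: eventually_mono)
    then show "kappa P X' T r g y = (1 / r) * (\<integral>i. g (y + i) \<partial>\<nu>)"
      by (simp add: kappa_def val_T)
  qed
  have k_mono: "mono (kappa P X' T r g)"
    unfolding kappa using r mono_average[OF g(1) int_fall]
    by (auto simp: mono_def intro!: divide_right_mono)
  have k_cont: "continuous_on UNIV (kappa P X' T r g)"
    unfolding kappa by (intro continuous_on_mult continuous_on_const continuous_on_average g int_fall)
  have avg: "integrable (A.law_at_expo x r (levy.rise X)) (\<lambda>s. \<integral>i. g (x + s + i) \<partial>\<nu>)"
    "(\<integral>s. (\<integral>i. g (x + s + i) \<partial>\<nu>) \<partial>A.law_at_expo x r (levy.rise X)) = (\<integral>z. g (x + z) \<partial>A.law_at_expo x r (levy.incr X))" for x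
    using A.integral_rise_average[OF r gm int_incr, of x x] unfolding fall_law by simp_all
  have "integrable (A.law_at_expo x r (levy.rise X)) (\<lambda>s. kappa P X' T r g (x + s))" for x
    unfolding kappa by (intro integrable_mult_right avg)
  note sup = A.discounted_integral_running_sup[OF r k_mono k_cont this]
  show "finite_mean_time_integral (P x) R" unfolding R_def by (rule sup(1))
  have "mean_time_integral (P x) R = (1 / r) * (\<integral>z. g (x + z) \<partial>A.law_at_expo x r (levy.incr X))"
    unfolding R_def sup(2) unfolding kappa using avg(2)[of x] by simp
  then show "mean_time_integral (P x) R = mean_time_integral (P x) (\<lambda>t \<omega>. g (X t \<omega>) * exp (- r * t))"
    by (simp only: A.discounted_integral_incr(2)[OF r g fin])
qed

lemma running_inf_uminus: "running_inf (\<lambda>t \<omega>. - Y t \<omega>) t \<omega> = - running_sup Y t \<omega>"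
  using uminus_SUP_uminus[of "\<lambda>s. - Y s \<omega>" "{0..t}"] by (simp add: running_inf_def running_sup_def)

theorem proposition10:
  fixes P :: "real \<Rightarrow> 'a measure"
    and X X' :: "real \<Rightarrow> 'a \<Rightarrow> real"
    and T' :: "'a \<Rightarrow> real"
    and r :: real
    and g G :: "real \<Rightarrow> real"
  assumes "r > 0"
    and "levy_family P X"
    and "independent_copy P X X'"
    and "independent_exponential_time P X X' T' r"
    and "continuous_on UNIV g"
    and "mono g \<or> antimono g"
    and "\<And>x. G x = mean_time_integral (P x) (\<lambda>t \<omega>. g (X t \<omega>) * exp (- r * t))"
    and "\<And>x. finite_mean_time_integral (P x) (\<lambda>t \<omega>. g (X t \<omega>) * exp (- r * t))"
  shows "(mono g \<longrightarrow>
            (\<forall>x. integrable (P 0) (\<lambda>\<omega>. g (x + running_inf X' (T' \<omega>) \<omega>))) \<and>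
            (\<forall>x. finite_mean_time_integral (P x)
                   (\<lambda>t \<omega>. running_sup (\<lambda>s \<omega>. kappa P X' T' r g (X s \<omega>)) t \<omega> * (r * exp (- r * t))) \<and>
                 G x = mean_time_integral (P x)
                   (\<lambda>t \<omega>. running_sup (\<lambda>s \<omega>. kappa P X' T' r g (X s \<omega>)) t \<omega> * (r * exp (- r * t))))) \<and>
         (antimono g \<longrightarrow>
            (\<forall>x. integrable (P 0) (\<lambda>\<omega>. g (x + running_sup X' (T' \<omega>) \<omega>))) \<and>
            (\<forall>x. finite_mean_time_integral (P x)
                   (\<lambda>t \<omega>. running_sup (\<lambda>s \<omega>. mu P X' T' r g (X s \<omega>)) t \<omega> * (r * exp (- r * t))) \<and>
                 G x = mean_time_integral (P x)
                   (\<lambda>t \<omega>. running_sup (\<lambda>s \<omega>. mu P X' T' r g (X s \<omega>)) t \<omega> * (r * exp (- r * t)))))"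
proof -
  have X': "levy_family P X'"
    and copy: "distr (P 0) path_space (path X') = distr (P 0) path_space (path X)"
    using assms(3) unfolding independent_copy_def by auto
  have T: "distributed (P 0) lborel T' (exponential_density r)"
    and indep: "prob_space.indep_set (P 0) (generated_sets (P 0) borel T')
      (generated_sets (P 0) (path_space \<Otimes>\<^sub>M path_space) (\<lambda>\<omega>. (path X \<omega>, path X' \<omega>)))"
    using assms(4) unfolding independent_exponential_time_def by auto
  interpret A: levy "P 0" X 0 by (rule levy_family_levy[OF assms(2)])
  interpret B: levy "P 0" X' 0 by (rule levy_family_levy[OF X'])
  have pX: "path X \<in> P 0 \<rightarrow>\<^sub>M path_space" by (rule path_measurable[OF A.X_measurable])
  have pX': "path X' \<in> P 0 \<rightarrow>\<^sub>M path_space" by (rule path_measurable[OF B.X_measurable])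
  have indep': "A.indep_set (generated_sets (P 0) borel T') (generated_sets (P 0) path_space (\<lambda>\<omega>. h (path X' \<omega>)))"
    if h: "h \<in> path_space \<rightarrow>\<^sub>M path_space" for h
  proof -
    have "generated_sets (P 0) path_space (\<lambda>\<omega>. h (path X' \<omega>))
        \<subseteq> generated_sets (P 0) (path_space \<Otimes>\<^sub>M path_space) (\<lambda>\<omega>. (path X \<omega>, path X' \<omega>))"
      using generated_sets_comp_subset[OF measurable_Pair[OF pX pX'] measurable_compose[OF measurable_snd h]]
      by simp
    then show ?thesis
      using indep unfolding A.indep_set_def
      by (elim A.indep_sets_mono_sets) (auto split: bool.split)
  qed
  have inc: "integrable (P 0) (\<lambda>\<omega>. g (x + running_inf X' (T' \<omega>) \<omega>))"
      "finite_mean_time_integral (P x) (\<lambda>t \<omega>. running_sup (\<lambda>s \<omega>. kappa P X' T' r g (X s \<omega>)) t \<omega> * (r * exp (- r * t)))"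
      "G x = mean_time_integral (P x) (\<lambda>t \<omega>. running_sup (\<lambda>s \<omega>. kappa P X' T' r g (X s \<omega>)) t \<omega> * (r * exp (- r * t)))"
    if "mono g" for x
    using increasing_payoff_representation[OF assms(1,2) X' copy T _ that assms(5,8)] indep'[of "\<lambda>p. p"] assms(7) by auto
  have dec: "integrable (P 0) (\<lambda>\<omega>. g (x + running_sup X' (T' \<omega>) \<omega>))"
      "finite_mean_time_integral (P x) (\<lambda>t \<omega>. running_sup (\<lambda>s \<omega>. mu P X' T' r g (X s \<omega>)) t \<omega> * (r * exp (- r * t)))"
      "G x = mean_time_integral (P x) (\<lambda>t \<omega>. running_sup (\<lambda>s \<omega>. mu P X' T' r g (X s \<omega>)) t \<omega> * (r * exp (- r * t)))"
    if "antimono g" for x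
  proof -
    let ?P = "\<lambda>x. P (- x)" and ?X = "\<lambda>t \<omega>. - X t \<omega>" and ?X' = "\<lambda>t \<omega>. - X' t \<omega>" and ?g = "\<lambda>z. g (- z)"
    have mono: "mono ?g" using that by (auto simp: mono_def antimono_def)
    have cont: "continuous_on UNIV ?g"
      by (rule continuous_on_compose2[OF assms(5)]) (auto intro!: continuous_intros)
    have copy': "distr (?P 0) path_space (path ?X') = distr (?P 0) path_space (path ?X)"
      using path_law_uminus[OF pX' pX copy] by simp
    have T0: "distributed (?P 0) lborel T' (exponential_density r)" using T by simp
    have ind0: "prob_space.indep_set (?P 0) (generated_sets (?P 0) borel T') (generated_sets (?P 0) path_space (path ?X'))"
      using indep'[OF uminus_path_measurable] by (simp add: path_uminus[abs_def])
    have fin0: "finite_mean_time_integral (?P z) (\<lambda>t \<omega>. ?g (?X t \<omega>) * exp (- r * t))" for z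
      using assms(8)[of "- z"] by simp
    have kappa_mu: "kappa ?P ?X' T' r ?g (- z) = mu P X' T' r g z" for z
      by (simp add: kappa_def mu_def running_inf_uminus add.commute)
    note * = increasing_payoff_representation[OF assms(1) levy_family_uminus[OF assms(2)] levy_family_uminus[OF X'] copy' T0 ind0 mono cont fin0]
    show "integrable (P 0) (\<lambda>\<omega>. g (x + running_sup X' (T' \<omega>) \<omega>))"
      using *(1)[of "- x"] by (simp add: running_inf_uminus add.commute)
    show "finite_mean_time_integral (P x) (\<lambda>t \<omega>. running_sup (\<lambda>s \<omega>. mu P X' T' r g (X s \<omega>)) t \<omega> * (r * exp (- r * t)))"
      using *(2)[of "- x"] by (simp add: kappa_mu)
    show "G x = mean_time_integral (P x) (\<lambda>t \<omega>. running_sup (\<lambda>s \<omega>. mu P X' T' r g (X s \<omega>)) t \<omega> * (r * exp (- r * t)))"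
      using *(3)[of "- x"] assms(7)[of x] by (simp add: kappa_mu)
  qed
  show ?thesis using inc dec by blast
qed

end
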